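(* Let $\{(\boldsymbol X(t),V(t)),t\ge 0\}$ be the cyclic random motion in $\mathbb R^3$ with the regular-tetrahedron directions described in the context, speed $c>0$, started from the origin with initial direction $\vec v_1$, and with intertimes along $\vec v_j$ given by independent geometric counting processes with intensities $\lambda_j>0$, $1\le j\le4$. Then for all $t\ge0$ $$\eta_1(t):=\mathbb P_1\{\boldsymbol X(t)=(ct,0,0),\,V(t)=\vec v_1\}=\frac1{1+\lambda_1t},$$ $$\eta_2(t):=\mathbb P_1\{\boldsymbol X(t)\in E_{12}(t),\,V(t)=\vec v_2\}=\frac{\lambda_1}{(\lambda_1+\lambda_2+\lambda_1\lambda_2t)^2}\Bigg\{\frac{\lambda_1t(\lambda_1+\lambda_2+\lambda_1\lambda_2t)}{1+\lambda_1t}+\lambda_2\log\big[(1+\lambda_1t)(1+\lambda_2t)\big]\Bigg\},$$ and $$\eta_3(t):=\mathbb P_1\{\boldsymbol X(t)\in F_{123}(t),\,V(t)=\vec v_3\}=R_\lambda(t),$$ where for $\lambda_1=\lambda_2=\lambda_3=\lambda$ one has $$\begin{aligned}R_\lambda(t)=\frac1{(2+\lambda t)^2(3+\lambda t)^3}\Bigg\{&2\log(1+\lambda t)\Big[(3+\lambda t)\big(\lambda t(3+2\lambda t)\big)+4(2+\lambda t)^2\log(2+\lambda t)\Big]\\&+(2+\lambda t)\Big[\pi^2(2+\lambda t)+\lambda t(3+\lambda t)^2-4(2+\lambda t)\log\Big(\frac1{2+\lambda t}\Big)\log\Big(\frac{1+\lambda t}{2+\lambda t}\Big)\Big]\\&+4(2+\lambda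 t)^2\Big[\mathrm{Li}_2\big(-(1+\lambda t)\big)+2\,\mathrm{Li}_2\Big(\frac{1+\lambda t}{2+\lambda t}\Big)\Big]\Bigg\}\end{aligned}$$ and $\mathrm{Li}_2$ is the dilogarithm function.
   Context: Directions: $\vec v_1=(1,0,0)$, $\vec v_2=(-\tfrac13,\tfrac{2\sqrt2}3,0)$, $\vec v_3=(-\tfrac13,-\tfrac{\sqrt2}3,\sqrt{\tfrac23})$, $\vec v_4=(-\tfrac13,-\tfrac{\sqrt2}3,-\sqrt{\tfrac23})$, and $A_j(t)=ct\,\vec v_j$. The points $A_j(t)$ are the vertices of a regular tetrahedron; $E_{12}(t)$ is its edge joining $A_1(t)$ and $A_2(t)$, and $F_{123}(t)$ is its face with vertices $A_1(t),A_2(t),A_3(t)$. Durations. For each $j\in\{1,2,3,4\}$, $(D_{j,k})_{k\ge1}$ is the sequence of interarrival times of a geometric counting process (GCP) with intensity $\lambda_j>0$: a mixed Poisson process whose random intensity $\alpha_j$ is exponentially distributed with mean $\lambda_j$ (given $\alpha_j$, the $D_{j,k}$, $k\ge 1$, are i.i.d. exponential with rate $\alpha_j$). The four sequences are mutually independent. Put $D_j^{(0)}=0$, $D_j^{(k)}=\sum_{i=1}^kD_{j,i}$. Motion. The particle starts at the origin at time $0$ with direction $\vec v_1$ and takes directions cyclically $\vec v_1\to\vec v_2\to\vec v_3\to\vec v_4\to\vec v_1\to\cdots$; during the $k$-th cycle it moves along $\vec v_j$ for a time $D_{j,k}$. Thus the switching times are $T_0=0$ and $T_{4n+j}=\sum_{r=1}^{j}D_r^{(n+1)}+\sum_{r=j+1}^{4}D_r^{(n)}$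 for $n\ge0$, $1\le j\le4$; $V(t)=\vec v_j$ for $T_{4n+j-1}\le t<T_{4n+j}$; and $\boldsymbol X(t)=c\int_0^tV(s)\,ds$. $\mathbb P_1$ denotes probability conditional on $\{\boldsymbol X(0)=\boldsymbol 0, V(0)=\vec v_1\}$. Dilogarithm: $\mathrm{Li}_2(z)=-\int_0^z\frac{\log(1-u)}u\,du$ for real $z\le1$.
   Formalization: The printed R_λ(t) is false (at t=0 it is about 0.345, but η_3(0)=0); in the version proved, λt(3+2λt) is replaced by λt(3+2λt)−3 and +2 Li_2((1+λt)/(2+λt)) by −2 Li_2((1+λt)/(2+λt)). *)

theory Defs
  imports "HOL-Probability.Probability"
begin

definition dir :: "nat \<Rightarrow> real ^ 3" where
  "dir j =
     (if j = 1 then vector [1, 0, 0]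
      else if j = 2 then vector [- (1 / 3), 2 * sqrt 2 / 3, 0]
      else if j = 3 then vector [- (1 / 3), - (sqrt 2 / 3), sqrt (2 / 3)]
      else vector [- (1 / 3), - (sqrt 2 / 3), - sqrt (2 / 3)])"

definition vertex :: "real \<Rightarrow> nat \<Rightarrow> real \<Rightarrow> real ^ 3" where
  "vertex c j t = (c * t) *\<^sub>R dir j"

definition edge12 :: "real \<Rightarrow> real \<Rightarrow> (real ^ 3) set" where
  "edge12 c t = closed_segment (vertex c 1 t) (vertex c 2 t)"

definition face123 :: "real \<Rightarrow> real \<Rightarrow> (real ^ 3) set" where
  "face123 c t = convex hull {vertex c 1 t, vertex c 2 t, vertex c 3 t}"

text \<open>
  Interarrival times \<open>D 1, D 2, \<dots>\<close> of a geometric counting process with intensity \<open>lam\<close>: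
  there is a random rate \<open>\<alpha>\<close>, exponential with mean \<open>lam\<close> (the library's exponential density
  is parametrised by the rate, hence \<open>1 / lam\<close>), such that conditionally on the sigma-algebra
  generated by \<open>\<alpha>\<close> the \<open>D k\<close> are i.i.d. exponential with rate \<open>\<alpha>\<close>.  The value \<open>D 0\<close> plays
  no role.
\<close>

definition gcp_interarrivals :: "'a measure \<Rightarrow> real \<Rightarrow> (nat \<Rightarrow> 'a \<Rightarrow> real) \<Rightarrow> bool" where
  "gcp_interarrivals M lam D \<longleftrightarrow>
     (\<forall>k\<ge>1. D k \<in> borel_measurable M) \<and>
     (\<exists>\<alpha>. distributed M lborel \<alpha> (\<lambda>x. ennreal (exponential_density (1 / lam) x)) \<and>
        (\<forall>J B. finite J \<and> J \<subseteq> {1..} \<and> (\<forall>k\<in>J. B k \<in> sets borel) \<longrightarrow>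
           (AE \<omega> in M.
              real_cond_exp M (vimage_algebra (space M) \<alpha> borel)
                (indicator {\<omega> \<in> space M. \<forall>k\<in>J. D k \<omega> \<in> B k}) \<omega> =
              (\<Prod>k\<in>J. measure (density lborel (\<lambda>x. ennreal (exponential_density (\<alpha> \<omega>) x))) (B k)))))"

text \<open>Below, \<open>D j k\<close> is the duration of the \<open>k\<close>-th motion along \<open>dir j\<close>
  (\<open>1 \<le> j \<le> 4\<close>, \<open>k \<ge> 1\<close>).\<close>

definition total_duration :: "(nat \<Rightarrow> nat \<Rightarrow> 'a \<Rightarrow> real) \<Rightarrow> nat \<Rightarrow> nat \<Rightarrow> 'a \<Rightarrow> real" where
  "total_duration D j k \<omega> = (\<Sum>i=1..k. D j i \<omega>)"

text \<open>
  With \<open>m = 4 * n + j\<close>, \<open>n = m div 4\<close>, \<open>j = m mod 4\<close>.  The case \<open>j = 4\<close> of the usual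
  indexing by \<open>1 \<le> j \<le> 4\<close> appears here as \<open>j = 0\<close> with \<open>n + 1\<close> in place of \<open>n\<close>, with the
  same value; for \<open>m = 0\<close> the sum is \<open>0\<close>.
\<close>

definition switch_time :: "(nat \<Rightarrow> nat \<Rightarrow> 'a \<Rightarrow> real) \<Rightarrow> nat \<Rightarrow> 'a \<Rightarrow> real" where
  "switch_time D m \<omega> =
     (\<Sum>r = 1..m mod 4. total_duration D r (m div 4 + 1) \<omega>) +
     (\<Sum>r = m mod 4 + 1..4. total_duration D r (m div 4) \<omega>)"

text \<open>
  Almost surely the switching times increase strictly to infinity, so exactly one \<open>m\<close>
  qualifies; \<open>LEAST\<close> (instead of \<open>THE\<close>) keeps the velocity measurable on the
  exceptional null set as well.
\<close>

definition velocity :: "(nat \<Rightarrow> nat \<Rightarrow> 'a \<Rightarrow> real) \<Rightarrow> real \<Rightarrow> 'a \<Rightarrow> real ^ 3" where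
  "velocity D t \<omega> =
     dir ((LEAST m. switch_time D m \<omega> \<le> t \<and> t < switch_time D (m + 1) \<omega>) mod 4 + 1)"

definition position :: "real \<Rightarrow> (nat \<Rightarrow> nat \<Rightarrow> 'a \<Rightarrow> real) \<Rightarrow> real \<Rightarrow> 'a \<Rightarrow> real ^ 3" where
  "position c D t \<omega> = c *\<^sub>R integral {0..t} (\<lambda>s. velocity D s \<omega>)"

definition prob1 ::
  "'a measure \<Rightarrow> real \<Rightarrow> (nat \<Rightarrow> nat \<Rightarrow> 'a \<Rightarrow> real) \<Rightarrow> ('a \<Rightarrow> bool) \<Rightarrow> real" where
  "prob1 M c D P = \<P>(\<omega> in M. P \<omega> \<bar> position c D 0 \<omega> = 0 \<and> velocity D 0 \<omega> = dir 1)"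

text \<open>The dilogarithm for real \<open>z \<le> 1\<close>; the integral is oriented, so \<open>z < 0\<close> is covered.\<close>

definition dilog :: "real \<Rightarrow> real" where
  "dilog z = - (LBINT u=ereal 0..ereal z. ln (1 - u) / u)"

text \<open>
  The formula in circulation for this function has \<open>l * t * (3 + 2 * l * t)\<close> without the
  summand \<open>- 3\<close>, and \<open>+ 2 * dilog (\<dots>)\<close> instead of \<open>- 2 * dilog (\<dots>)\<close>.  Both are misprints:
  that formula has the value \<open>(4 * pi\<^sup>2 / 3 - 8 * (ln 2)\<^sup>2) / 27 > 0\<close> at \<open>t = 0\<close>, where the
  probability in question is \<open>0\<close>.  The version below results from evaluating the convolution
  integral \<open>\<integral> l / (1 + l * s)\<^sup>2 * \<eta>\<^sub>2 (t - s) ds\<close> over \<open>{0..t}\<close>, where \<open>\<eta>\<^sub>2\<close> is the probability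
  for the edge with equal intensities.
\<close>

definition R_face :: "real \<Rightarrow> real \<Rightarrow> real" where
  "R_face l t =
     1 / ((2 + l * t)\<^sup>2 * (3 + l * t) ^ 3) *
     (2 * ln (1 + l * t) *
        ((3 + l * t) * (l * t * (3 + 2 * l * t) - 3)
         + 4 * (2 + l * t)\<^sup>2 * ln (2 + l * t))
      + (2 + l * t) *
        (pi\<^sup>2 * (2 + l * t) + l * t * (3 + l * t)\<^sup>2
         - 4 * (2 + l * t) * ln (1 / (2 + l * t)) * ln ((1 + l * t) / (2 + l * t)))
      + 4 * (2 + l * t)\<^sup>2 *
        (dilog (- (1 + l * t)) - 2 * dilog ((1 + l * t) / (2 + l * t))))"

end

theory Submission
  imports Defs "HOL-Real_Asymp.Real_Asymp"
begin

text \<open>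
  The four directions are the vertices of a simplex, and \<open>X(t) / (c t)\<close> is their mean, weighted by
  the fractions of \<open>{0..t}\<close> spent along each of them.  For the vertex, edge and face through
  \<open>v\<^sub>1, \<dots>, v\<^sub>m\<close> there is a linear functional that takes its minimum over the directions exactly at
  \<open>v\<^sub>1, \<dots>, v\<^sub>m\<close>; so the particle lies there only if it has spent no time along the other directions.
  Together with \<open>V(t) = v\<^sub>m\<close> this says that the \<open>m\<close>-th leg of the first cycle is under way at
  time \<open>t\<close>: as soon as leg \<open>m + 1\<close> has lasted for a positive time the face is left for good, whatever
  the particle does afterwards, even if the switching times accumulate.  This gives
  \<open>at_vertex_iff\<close>, \<open>on_edge_iff\<close> and \<open>on_face_iff\<close>, and the three probabilities become those of
  \<open>t < D\<^sub>1\<close>, of \<open>D\<^sub>1 \<le> t < D\<^sub>1 + D\<^sub>2\<close> and of \<open>D\<^sub>1 + D\<^sub>2 \<le> t < D\<^sub>1 + D\<^sub>2 + D\<^sub>3\<close>, where \<open>D\<^sub>j\<close> is the first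
  duration along \<open>v\<^sub>j\<close>.

  Averaging the exponential tail over the exponentially distributed rate shows that \<open>D\<^sub>j\<close> has the tail
  \<open>1 / (1 + \<lambda>\<^sub>j s)\<close> (\<open>gcp_interarrival_tail\<close>), hence the density \<open>\<lambda>\<^sub>j / (1 + \<lambda>\<^sub>j s)\<^sup>2\<close>.  By independence the
  second and the third probability are convolutions of this density with the tail and with the
  second probability, respectively (\<open>emeasure_second_sojourn\<close>, \<open>emeasure_third_sojourn\<close>).

  The first convolution is elementary, by partial fractions.  In the second one, with equal
  intensities \<open>\<lambda>\<close>, put \<open>a = 2 + \<lambda> t\<close> and \<open>u = 1 + \<lambda> (t - s)\<close>.  It becomes the integral over \<open>{1..a - 1}\<close> of
  \<open>((u - 1) / (u (1 + u)) + 2 ln u / (1 + u)\<^sup>2) / (a - u)\<^sup>2\<close>,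
  and partial fractions leave, besides elementary terms, \<open>ln u / (a - u)\<close> and \<open>ln u / (1 + u)\<close>, whose
  primitives involve \<open>Li\<^sub>2(u / a)\<close> and \<open>Li\<^sub>2(-u)\<close> (\<open>DERIV_face_antideriv\<close>).  The lower limit \<open>u = 1\<close>
  contributes \<open>Li\<^sub>2(-1) = - \<pi>\<^sup>2 / 12\<close> and \<open>Li\<^sub>2(1 / a)\<close>; the reflection formula turns the latter into
  \<open>Li\<^sub>2((a - 1) / a)\<close>, the value at the upper limit.
\<close>

section \<open>Trajectories on the boundary of the tetrahedron\<close>

lemma inner_dir:
  assumes "i \<in> {1..4}" "j \<in> {1..4}"
  shows "dir i \<bullet> dir j = (if i = j then 1 else - (1 / 3))"
proof -
  have "i = 1 \<or> i = 2 \<or> i = 3 \<or> i = 4" "j = 1 \<or> j = 2 \<or> j = 3 \<or> j = 4"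
    using assms by auto
  then show ?thesis
    by (elim disjE) (simp_all add: dir_def inner_vec_def sum_3 mult.assoc mult.left_commute[of "sqrt 2" 2])
qed

lemma dir_eq_iff:
  assumes "i \<in> {1..4}" "j \<in> {1..4}"
  shows "dir i = dir j \<longleftrightarrow> i = j"
  using inner_dir[OF assms] inner_dir[OF assms(1) assms(1)] by (auto split: if_splits)

lemma velocity_cases:
  obtains j where "j \<in> {1..4}" "velocity D s \<omega> = dir j"
proof (rule that)
  let ?m = "LEAST m. switch_time D m \<omega> \<le> s \<and> s < switch_time D (m + 1) \<omega>"
  show "?m mod 4 + 1 \<in> {1..4}"
    using mod_less_divisor[of 4 ?m] by simp
qed (simp add: velocity_def)

lemma switch_time_first_cycle:
  assumes "m \<le> 4"
  shows "switch_time D m \<omega> = (\<Sum>j=1..m. D j 1 \<omega>)"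
proof -
  have s: "{1..2} = {1, 2::nat}" "{1..3} = {1, 2, 3::nat}" "{1..4} = {1, 2, 3, 4::nat}" by auto
  have "m = 0 \<or> m = 1 \<or> m = 2 \<or> m = 3 \<or> m = 4"
    using assms by auto
  then show ?thesis
    by (elim disjE) (simp_all add: switch_time_def total_duration_def s[unfolded One_nat_def])
qed

lemma switch_time_nonneg:
  assumes "\<And>j. j \<in> {1..4} \<Longrightarrow> D j 1 \<omega> > 0" and "m \<le> 4"
  shows "switch_time D m \<omega> \<ge> 0"
  unfolding switch_time_first_cycle[OF assms(2)]
  using assms(2) by (intro sum_nonneg less_imp_le assms(1)) auto

lemma switch_times:
  "switch_time D 0 \<omega> = 0"
  "switch_time D 1 \<omega> = D 1 1 \<omega>"
  "switch_time D 2 \<omega> = D 1 1 \<omega> + D 2 1 \<omega>"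
  "switch_time D 3 \<omega> = D 1 1 \<omega> + D 2 1 \<omega> + D 3 1 \<omega>"
  using switch_time_first_cycle[of _ D \<omega>] 
  by (simp_all add: sum.atLeast_Suc_atMost numeral_2_eq_2 numeral_3_eq_3)

text \<open>
  The inequalities hold for no index below \<open>m\<close>, because \<open>T\<^sub>0 \<le> \<dots> \<le> T\<^sub>4\<close> when the
  durations of the first cycle are positive; so \<open>m\<close> is the index that \<open>LEAST\<close> selects.
\<close>

lemma velocity_first_cycle:
  assumes pos: "\<And>j. j \<in> {1..4} \<Longrightarrow> D j 1 \<omega> > 0"
    and "m < 4" "switch_time D m \<omega> \<le> s" "s < switch_time D (m + 1) \<omega>"
  shows "velocity D s \<omega> = dir (m + 1)"
proof -
  have mono: "switch_time D i \<omega> \<le> switch_time D k \<omega>" if "i \<le> k" "k \<le> 4" for i k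
  proof -
    have "0 \<le> D j 1 \<omega>" if "j \<in> {1..k}" for j
      using that \<open>k \<le> 4\<close> by (intro less_imp_le pos) auto
    then show ?thesis
      using that unfolding switch_time_first_cycle[OF that(2)] switch_time_first_cycle[OF order.trans[OF that]]
      by (intro sum_mono2) auto
  qed
  have "(LEAST m. switch_time D m \<omega> \<le> s \<and> s < switch_time D (m + 1) \<omega>) = m"
  proof (rule Least_equality)
    fix k assume k: "switch_time D k \<omega> \<le> s \<and> s < switch_time D (k + 1) \<omega>"
    show "m \<le> k"
    proof (rule ccontr)
      assume "\<not> m \<le> k"
      then have "switch_time D (k + 1) \<omega> \<le> switch_time D m \<omega>"
        using assms(2) by (intro mono) auto
      then show False using k assms(3) by simp
    qed
  qed (use assms in auto)
  then show ?thesis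
    using assms(2) by (simp add: velocity_def)
qed

text \<open>
  Position and velocity are measurable on all of the sample space, also where the durations are
  negative or the switching times accumulate: the velocity always takes one of four values and is
  jointly measurable in time and sample point, so that the Henstock-Kurzweil integral in the position
  is a Lebesgue integral of a bounded measurable function.
\<close>

context
  fixes M :: "'a measure" and D :: "nat \<Rightarrow> nat \<Rightarrow> 'a \<Rightarrow> real"
  assumes D_measurable: "\<And>j k. j \<in> {1..4} \<Longrightarrow> k \<ge> 1 \<Longrightarrow> D j k \<in> borel_measurable M"
begin

lemma switch_time_measurable: "switch_time D m \<in> borel_measurable M"
proof -
  have "m mod 4 < 4" by simp
  then show ?thesis
  unfolding switch_time_def[abs_def] total_duration_def
  by (intro borel_measurable_add borel_measurable_sum D_measurable) auto
qed

lemma velocity_measurable_pair: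
  "(\<lambda>(s, \<omega>). velocity D s \<omega>) \<in> borel_measurable (borel \<Otimes>\<^sub>M M)"
proof -
  note [measurable] = switch_time_measurable
  have [measurable]: "dir \<in> count_space UNIV \<rightarrow>\<^sub>M borel" by simp
  show ?thesis unfolding velocity_def by measurable
qed

lemma velocity_measurable: "velocity D t \<in> borel_measurable M"
  using measurable_compose[OF _ velocity_measurable_pair, of "\<lambda>\<omega>. (t, \<omega>)" M] by simp

lemma velocity_set_integrable:
  assumes "\<omega> \<in> space M"
  shows "set_integrable lborel {a..b} (\<lambda>s. velocity D s \<omega>)"
proof (rule set_integrable_bound)
  have [measurable]: "(\<lambda>s. velocity D s \<omega>) \<in> borel_measurable borel"
    using measurable_compose[OF _ velocity_measurable_pair, of "\<lambda>s. (s, \<omega>)" borel] assms by simp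
  show "set_borel_measurable lborel {a..b} (\<lambda>s. velocity D s \<omega>)"
    unfolding set_borel_measurable_def by measurable
  show "set_integrable lborel {a..b} (\<lambda>s. 1 :: real)"
    by (rule borel_integrable_atLeastAtMost') (rule continuous_on_const)
  have "norm (velocity D s \<omega>) \<le> 1" for s
  proof -
    obtain j where "j \<in> {1..4}" "velocity D s \<omega> = dir j" by (rule velocity_cases)
    then show ?thesis by (simp add: norm_eq_sqrt_inner inner_dir)
  qed
  then show "AE s in lborel. s \<in> {a..b} \<longrightarrow> norm (velocity D s \<omega>) \<le> norm (1 :: real)"
    by simp
qed

lemma velocity_integrable_on:
  "\<omega> \<in> space M \<Longrightarrow> (\<lambda>s. velocity D s \<omega>) integrable_on {a..b}"
  by (rule set_borel_integral_eq_integral(1)[OF velocity_set_integrable])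

lemma position_measurable: "position c D t \<in> borel_measurable M"
proof -
  note [measurable] = velocity_measurable_pair
  have "(\<lambda>\<omega>. c *\<^sub>R (\<integral>s. indicator {0..t} s *\<^sub>R velocity D s \<omega> \<partial>lborel)) \<in> borel_measurable M"
    by measurable
  moreover have "position c D t \<omega> = c *\<^sub>R (\<integral>s. indicator {0..t} s *\<^sub>R velocity D s \<omega> \<partial>lborel)"
    if "\<omega> \<in> space M" for \<omega>
    using set_borel_integral_eq_integral(2)[OF velocity_set_integrable[OF that, of 0 t]]
    by (simp add: position_def set_lebesgue_integral_def)
  ultimately show ?thesis by (simp cong: measurable_cong)
qed

end

text \<open>
  Spending a time interval in the region where the functional \<open>u\<close> exceeds its minimum \<open>\<mu>\<close> moves the
  integral strictly off the supporting hyperplane.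
\<close>

lemma integral_inner_gt:
  fixes v :: "real \<Rightarrow> 'b :: euclidean_space"
  assumes int: "v integrable_on {0..t}"
    and ab: "0 \<le> a" "a < b" "b \<le> t"
    and lower: "\<And>s. s \<in> {0..t} \<Longrightarrow> \<mu> \<le> u \<bullet> v s"
    and strict: "\<And>s. s \<in> {a..b} \<Longrightarrow> \<nu> \<le> u \<bullet> v s" and "\<mu> < \<nu>"
  shows "t * \<mu> < u \<bullet> integral {0..t} v"
proof -
  have uv: "((\<lambda>s. u \<bullet> v s) has_integral u \<bullet> integral {0..t} v) {0..t}"
    using has_integral_linear[OF integrable_integral[OF int] bounded_linear_inner_right[of u]]
    by (simp add: o_def)
  have g: "((\<lambda>s. u \<bullet> v s - \<mu>) has_integral u \<bullet> integral {0..t} v - t * \<mu>) {0..t}"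
    using has_integral_diff[OF uv has_integral_const_real[of \<mu> 0 t]] ab by simp
  have sub: "{a..b} \<subseteq> {0..t}" using ab by auto
  have g': "(\<lambda>s. u \<bullet> v s - \<mu>) integrable_on {a..b}"
    using integrable_on_subinterval[OF has_integral_integrable[OF g]] sub by auto
  have "0 < (b - a) * (\<nu> - \<mu>)"
    using ab \<open>\<mu> < \<nu>\<close> by simp
  also have "\<dots> = integral {a..b} (\<lambda>s. \<nu> - \<mu>)"
    using ab by simp
  also have "\<dots> \<le> integral {a..b} (\<lambda>s. u \<bullet> v s - \<mu>)"
    using strict by (intro integral_le g') auto
  also have "\<dots> \<le> integral {0..t} (\<lambda>s. u \<bullet> v s - \<mu>)"
    using lower sub by (intro integral_subset_le g' has_integral_integrable[OF g]) auto
  also have "\<dots> = u \<bullet> integral {0..t} v - t * \<mu>"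
    using g by blast
  finally show ?thesis by simp
qed

text \<open>
  The functional \<open>u\<close> exposes the face spanned by the first \<open>m + 1\<close> directions.  Before the leg in
  question the velocity is an earlier direction.  At its end the velocity is already \<open>dir (m + 2)\<close>,
  and any time after that is preceded by an interval of travel along \<open>dir (m + 2)\<close>, off the face.
\<close>

lemma time_in_leg_if_position_on_face:
  assumes pos: "\<And>j. j \<in> {1..4} \<Longrightarrow> D j 1 \<omega> > 0"
    and int: "(\<lambda>s. velocity D s \<omega>) integrable_on {0..t}"
    and "c > 0" "t \<ge> 0" "m < 3"
    and u: "\<And>j. j \<in> {1..m + 1} \<Longrightarrow> u \<bullet> dir j = \<mu>"
      "\<And>j. j \<in> {m + 2..4} \<Longrightarrow> u \<bullet> dir j > \<mu>"
    and X: "u \<bullet> position c D t \<omega> = c * t * \<mu>" and V: "velocity D t \<omega> = dir (m + 1)"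
  shows "switch_time D m \<omega> \<le> t \<and> t < switch_time D (m + 1) \<omega>"
proof (intro conjI; rule ccontr)
  note vel = velocity_first_cycle[of D \<omega>, OF pos]
  assume *: "\<not> switch_time D m \<omega> \<le> t"
  have "\<exists>k<m. switch_time D k \<omega> \<le> t \<and> t < switch_time D (k + 1) \<omega>"
  proof -
    let ?k = "LEAST n. t < switch_time D n \<omega>"
    have k: "t < switch_time D ?k \<omega>" "?k \<le> m"
      using * LeastI[of "\<lambda>n. t < switch_time D n \<omega>" m] by (auto intro: Least_le)
    have "?k \<noteq> 0"
      using k(1) \<open>t \<ge> 0\<close> switch_time_first_cycle[of 0 D \<omega>] by (intro notI) simp
    moreover from this have "\<not> t < switch_time D (?k - 1) \<omega>"
      by (intro not_less_Least) simp
    ultimately show ?thesis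
      using k by (intro exI[of _ "?k - 1"]) auto
  qed
  then obtain k where "k < m" "velocity D t \<omega> = dir (k + 1)"
    using vel \<open>m < 3\<close> by fastforce
  then show False
    using V \<open>m < 3\<close> dir_eq_iff[of "k + 1" "m + 1"] by auto
next
  note vel = velocity_first_cycle[of D \<omega>, OF pos]
  assume *: "\<not> t < switch_time D (m + 1) \<omega>"
  let ?a = "switch_time D (m + 1) \<omega>" and ?b = "switch_time D (m + 2) \<omega>"
  have a0: "0 \<le> ?a"
    using \<open>m < 3\<close> by (intro switch_time_nonneg pos) auto
  have ab: "?a < ?b"
    using \<open>m < 3\<close> pos[of "m + 2"] by (simp add: switch_time_first_cycle)
  have V2: "velocity D s \<omega> = dir (m + 2)" if "?a \<le> s" "s < ?b" for s
    using vel[of "m + 1" s] that \<open>m < 3\<close> by simp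
  have "t \<noteq> ?a"
    using V V2[of t] ab dir_eq_iff[of "m + 1" "m + 2"] \<open>m < 3\<close> by auto
  \<comment> \<open>The midpoint keeps the closed interval strictly inside the leg, whose right end point belongs to the next leg.\<close>
  define b where "b = min t ((?a + ?b) / 2)"
  have b: "?a < b" "b \<le> t" "b < ?b"
    using * \<open>t \<noteq> ?a\<close> ab unfolding b_def min_def by (auto simp del: One_nat_def)
  have "t * \<mu> < u \<bullet> integral {0..t} (\<lambda>s. velocity D s \<omega>)"
  proof (rule integral_inner_gt[OF int a0 b(1,2)])
    fix s
    obtain j where j: "j \<in> {1..4}" "velocity D s \<omega> = dir j" by (rule velocity_cases)
    have "j \<in> {1..m + 1} \<or> j \<in> {m + 2..4}"
      using j(1) by auto
    then show "\<mu> \<le> u \<bullet> velocity D s \<omega>"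
      using u(1)[of j] u(2)[of j] unfolding j(2) by auto
  next
    fix s assume "s \<in> {?a..b}"
    then show "u \<bullet> dir (m + 2) \<le> u \<bullet> velocity D s \<omega>"
      using V2[of s] b by simp
  qed (use u(2)[of "m + 2"] \<open>m < 3\<close> in simp)
  then have "c * (t * \<mu>) < u \<bullet> position c D t \<omega>"
    using \<open>c > 0\<close> by (simp add: position_def)
  then show False using X by (simp add: mult.assoc)
qed

lemma velocity_has_integral_leg:
  assumes pos: "\<And>j. j \<in> {1..4} \<Longrightarrow> D j 1 \<omega> > 0"
    and "m < 4" "switch_time D m \<omega> \<le> b" "b \<le> switch_time D (m + 1) \<omega>"
  shows "((\<lambda>s. velocity D s \<omega>) has_integral (b - switch_time D m \<omega>) *\<^sub>R dir (m + 1))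
     {switch_time D m \<omega>..b}"
proof (rule has_integral_spike_finite)
  show "((\<lambda>s. dir (m + 1)) has_integral (b - switch_time D m \<omega>) *\<^sub>R dir (m + 1))
     {switch_time D m \<omega>..b}"
    using has_integral_const_real[of "dir (m + 1)" "switch_time D m \<omega>" b] assms(3) by simp
  show "velocity D s \<omega> = dir (m + 1)" if "s \<in> {switch_time D m \<omega>..b} - {b}" for s
    using that assms by (intro velocity_first_cycle) auto
qed simp

lemma velocity_has_integral_first_cycle:
  assumes pos: "\<And>j. j \<in> {1..4} \<Longrightarrow> D j 1 \<omega> > 0"
    and "m \<le> 4"
  shows "((\<lambda>s. velocity D s \<omega>) has_integral (\<Sum>j=1..m. D j 1 \<omega> *\<^sub>R dir j))
     {0..switch_time D m \<omega>}"
  using assms(2)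
proof (induction m)
  case 0
  then show ?case using has_integral_refl(2)[of _ "0 :: real"] by (simp add: switch_times)
next
  case (Suc m)
  have step: "switch_time D (Suc m) \<omega> = switch_time D m \<omega> + D (m + 1) 1 \<omega>"
    using Suc.prems by (simp add: switch_time_first_cycle)
  have "0 \<le> switch_time D m \<omega>"
    using Suc.prems by (intro switch_time_nonneg pos) auto
  moreover have "D (m + 1) 1 \<omega> > 0"
    using Suc.prems by (intro pos) auto
  ultimately show ?case
    using has_integral_combine[OF _ _ Suc.IH velocity_has_integral_leg[of D \<omega> m "switch_time D (Suc m) \<omega>", OF pos]]
      Suc.prems step by simp
qed

lemma position_first_cycle:
  assumes pos: "\<And>j. j \<in> {1..4} \<Longrightarrow> D j 1 \<omega> > 0"
    and "m < 4" "switch_time D m \<omega> \<le> t" "t < switch_time D (m + 1) \<omega>"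
  shows "position c D t \<omega> =
     c *\<^sub>R ((\<Sum>j=1..m. D j 1 \<omega> *\<^sub>R dir j) + (t - switch_time D m \<omega>) *\<^sub>R dir (m + 1))"
proof -
  have "0 \<le> switch_time D m \<omega>"
    using assms(2) by (intro switch_time_nonneg pos) auto
  then have "((\<lambda>s. velocity D s \<omega>) has_integral
      ((\<Sum>j=1..m. D j 1 \<omega> *\<^sub>R dir j) + (t - switch_time D m \<omega>) *\<^sub>R dir (m + 1))) {0..t}"
    using assms
    by (intro has_integral_combine[OF _ assms(3) velocity_has_integral_first_cycle velocity_has_integral_leg]) auto
  then show ?thesis
    by (simp add: position_def integral_unique)
qed

text \<open>
  The exposing functionals are \<open>- v\<^sub>1\<close>, \<open>v\<^sub>3 + v\<^sub>4\<close> and \<open>v\<^sub>4\<close>; two distinct directions have inner product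
  \<open>- 1 / 3\<close>.
\<close>

context
  fixes D :: "nat \<Rightarrow> nat \<Rightarrow> 'a \<Rightarrow> real" and \<omega> :: 'a and c t :: real
  assumes pos: "\<And>j. j \<in> {1..4} \<Longrightarrow> D j 1 \<omega> > 0"
    and int: "(\<lambda>s. velocity D s \<omega>) integrable_on {0..t}"
    and c: "c > 0" and t: "t \<ge> 0"
begin

lemma at_vertex_iff:
  "position c D t \<omega> = vector [c * t, 0, 0] \<and> velocity D t \<omega> = dir 1 \<longleftrightarrow> t < D 1 1 \<omega>"
proof -
  have v: "vector [c * t, 0, 0] = (c * t) *\<^sub>R dir 1"
    by (simp add: dir_def vec_eq_iff forall_3)
  have "switch_time D 0 \<omega> \<le> t \<and> t < switch_time D (0 + 1) \<omega>"
    if "position c D t \<omega> = vector [c * t, 0, 0]" "velocity D t \<omega> = dir 1"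
  proof (rule time_in_leg_if_position_on_face[of D \<omega> t c 0 "- dir 1" "-1"])
    show "- dir 1 \<bullet> position c D t \<omega> = c * t * - 1"
      by (simp add: that v inner_dir)
  qed (use pos int c t that in \<open>auto simp: inner_dir\<close>)
  moreover have "position c D t \<omega> = vector [c * t, 0, 0] \<and> velocity D t \<omega> = dir 1"
    if "t < D 1 1 \<omega>"
    using position_first_cycle[of D \<omega> 0 t c, OF pos] velocity_first_cycle[of D \<omega> 0 t, OF pos] that t
    by (simp add: switch_time_first_cycle v)
  ultimately show ?thesis by (auto simp: switch_time_first_cycle)
qed

lemma on_edge_iff:
  "position c D t \<omega> \<in> edge12 c t \<and> velocity D t \<omega> = dir 2 \<longleftrightarrow>
     D 1 1 \<omega> \<le> t \<and> t < D 1 1 \<omega> + D 2 1 \<omega>"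
proof -
  have "switch_time D 1 \<omega> \<le> t \<and> t < switch_time D (1 + 1) \<omega>"
    if X: "position c D t \<omega> \<in> edge12 c t" and V: "velocity D t \<omega> = dir 2"
  proof (rule time_in_leg_if_position_on_face[of D \<omega> t c 1 "dir 3 + dir 4" "- (2 / 3)"])
    obtain \<theta> where \<theta>: "position c D t \<omega> = (1 - \<theta>) *\<^sub>R vertex c 1 t + \<theta> *\<^sub>R vertex c 2 t"
      using X by (auto simp: edge12_def closed_segment_def)
    show "(dir 3 + dir 4) \<bullet> position c D t \<omega> = c * t * - (2 / 3)"
      unfolding \<theta> by (simp add: vertex_def inner_add_left inner_add_right inner_dir) (simp add: field_simps)
    show "(dir 3 + dir 4) \<bullet> dir j = - (2 / 3)" if "j \<in> {1..1 + 1}" for j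
      using that by (auto simp: inner_add_left inner_dir)
    show "(dir 3 + dir 4) \<bullet> dir j > - (2 / 3)" if "j \<in> {1 + 2..4}" for j
      using that by (auto simp: inner_add_left inner_dir)
  qed (use pos int c t V in \<open>auto simp flip: numeral_2_eq_2\<close>)
  moreover have "position c D t \<omega> \<in> edge12 c t \<and> velocity D t \<omega> = dir 2"
    if that: "D 1 1 \<omega> \<le> t" "t < D 1 1 \<omega> + D 2 1 \<omega>"
  proof -
    have T: "switch_time D 1 \<omega> = D 1 1 \<omega>" "switch_time D (1 + 1) \<omega> = D 1 1 \<omega> + D 2 1 \<omega>"
      using switch_times[of D \<omega>] by (simp_all flip: numeral_2_eq_2)
    have "t > 0" using pos[of 1] that by simp
    have "position c D t \<omega> = c *\<^sub>R (D 1 1 \<omega> *\<^sub>R dir 1 + (t - D 1 1 \<omega>) *\<^sub>R dir 2)"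
      using position_first_cycle[of D \<omega> 1 t c, OF pos] that unfolding T by (simp flip: numeral_2_eq_2)
    also have "\<dots> = (1 - (t - D 1 1 \<omega>) / t) *\<^sub>R vertex c 1 t + ((t - D 1 1 \<omega>) / t) *\<^sub>R vertex c 2 t"
    proof -
      have "1 - (t - D 1 1 \<omega>) / t = D 1 1 \<omega> / t" using \<open>t > 0\<close> by (simp add: field_simps)
      then show ?thesis using \<open>t > 0\<close> by (simp add: vertex_def scaleR_add_right mult.commute)
    qed
    finally have "position c D t \<omega> \<in> edge12 c t"
      using that pos[of 1] \<open>t > 0\<close> unfolding edge12_def closed_segment_def
      by (auto intro!: exI[of _ "(t - D 1 1 \<omega>) / t"])
    moreover have "velocity D t \<omega> = dir 2"
      using velocity_first_cycle[of D \<omega> 1 t, OF pos] that unfolding T by (simp flip: numeral_2_eq_2)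
    ultimately show ?thesis by simp
  qed
  ultimately show ?thesis
    using switch_times[of D \<omega>] by (auto simp flip: numeral_2_eq_2)
qed

lemma on_face_iff:
  "position c D t \<omega> \<in> face123 c t \<and> velocity D t \<omega> = dir 3 \<longleftrightarrow>
     D 1 1 \<omega> + D 2 1 \<omega> \<le> t \<and> t < D 1 1 \<omega> + D 2 1 \<omega> + D 3 1 \<omega>"
proof -
  have T: "switch_time D 2 \<omega> = D 1 1 \<omega> + D 2 1 \<omega>"
    "switch_time D (2 + 1) \<omega> = D 1 1 \<omega> + D 2 1 \<omega> + D 3 1 \<omega>"
    using switch_times[of D \<omega>] by simp_all
  have "switch_time D 2 \<omega> \<le> t \<and> t < switch_time D (2 + 1) \<omega>"
    if X: "position c D t \<omega> \<in> face123 c t" and V: "velocity D t \<omega> = dir 3"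
  proof (rule time_in_leg_if_position_on_face[of D \<omega> t c 2 "dir 4" "- (1 / 3)"])
    obtain p q r where pqr: "p + q + r = 1"
      and X': "position c D t \<omega> = p *\<^sub>R vertex c 1 t + q *\<^sub>R vertex c 2 t + r *\<^sub>R vertex c 3 t"
      using X by (auto simp: face123_def convex_hull_3)
    from pqr have r: "r = 1 - p - q" by simp
    show "dir 4 \<bullet> position c D t \<omega> = c * t * - (1 / 3)"
      unfolding X' r by (simp add: vertex_def inner_add_right inner_dir) (simp add: field_simps)
    show "dir 4 \<bullet> dir j = - (1 / 3)" if "j \<in> {1..2 + 1}" for j
      using that by (auto simp: inner_dir)
    show "dir 4 \<bullet> dir j > - (1 / 3)" if "j \<in> {2 + 2..4}" for j
      using that by (auto simp: inner_dir)
  qed (use pos int c t V in \<open>auto simp flip: numeral_2_eq_2\<close>)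
  moreover have "position c D t \<omega> \<in> face123 c t \<and> velocity D t \<omega> = dir 3"
    if that: "D 1 1 \<omega> + D 2 1 \<omega> \<le> t" "t < D 1 1 \<omega> + D 2 1 \<omega> + D 3 1 \<omega>"
  proof -
    have "t > 0" using pos[of 1] pos[of 2] that by simp
    let ?r = "t - (D 1 1 \<omega> + D 2 1 \<omega>)"
    have "position c D t \<omega> = c *\<^sub>R (D 1 1 \<omega> *\<^sub>R dir 1 + D 2 1 \<omega> *\<^sub>R dir 2 + ?r *\<^sub>R dir 3)"
      using position_first_cycle[of D \<omega> 2 t c, OF pos] that unfolding T by (simp add: numeral_eq_Suc)
    also have "\<dots> = (D 1 1 \<omega> / t) *\<^sub>R vertex c 1 t + (D 2 1 \<omega> / t) *\<^sub>R vertex c 2 t + (?r / t) *\<^sub>R vertex c 3 t"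
      using \<open>t > 0\<close> by (simp add: vertex_def scaleR_add_right mult.commute)
    finally have X: "position c D t \<omega> =
      (D 1 1 \<omega> / t) *\<^sub>R vertex c 1 t + (D 2 1 \<omega> / t) *\<^sub>R vertex c 2 t + (?r / t) *\<^sub>R vertex c 3 t" .
    have "D 1 1 \<omega> / t + D 2 1 \<omega> / t + ?r / t = 1"
      using \<open>t > 0\<close> by (simp add: field_simps)
    moreover have "0 \<le> D 1 1 \<omega> / t" "0 \<le> D 2 1 \<omega> / t" "0 \<le> ?r / t"
      using that pos[of 1] pos[of 2] \<open>t > 0\<close> by simp_all
    ultimately have "position c D t \<omega> \<in> face123 c t"
      unfolding face123_def convex_hull_3 X by blast
    moreover have "velocity D t \<omega> = dir 3"
      using velocity_first_cycle[of D \<omega> 2 t, OF pos] that unfolding T by (simp add: numeral_eq_Suc)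
    ultimately show ?thesis by simp
  qed
  ultimately show ?thesis
    using T by auto
qed

end

section \<open>Interarrival times and convolutions\<close>

text \<open>
  The Lomax (Pareto type II) density with tail \<open>1 / (1 + l * x)\<close>.
\<close>

definition gcp_density :: "real \<Rightarrow> real \<Rightarrow> real" where
  "gcp_density l x = (if x < 0 then 0 else l / (1 + l * x)\<^sup>2)"

lemma gcp_density_measurable [measurable]: "gcp_density l \<in> borel_measurable borel"
  unfolding gcp_density_def[abs_def] by measurable

lemma gcp_density_nonneg: "l > 0 \<Longrightarrow> 0 \<le> gcp_density l x"
  by (simp add: gcp_density_def)

text \<open>
  For \<open>a \<le> 0\<close> the density is nowhere positive and \<open>ennreal\<close> cuts it to \<open>0\<close>, so the measure
  vanishes.  This case arises because the rate of a counting process is positive only almost surely.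
\<close>

lemma exponential_law_tail:
  assumes "s \<ge> 0"
  shows "measure (density lborel (\<lambda>x. ennreal (exponential_density a x))) {s<..} =
    (if a > 0 then exp (- a * s) else 0)"
proof (cases "a > 0")
  case True
  let ?E = "density lborel (\<lambda>x. ennreal (exponential_density a x))"
  interpret E: prob_space ?E
    by (rule prob_space_exponential_density[OF True])
  have "measure ?E {..s} = 1 - exp (- a * s)"
    using emeasure_erlang_density[OF True, of 0 s] assms True
    by (simp add: measure_def erlang_CDF_def)
  moreover have "measure ?E (space ?E - {..s}) = 1 - measure ?E {..s}"
    by (rule E.prob_compl) simp
  moreover have "space ?E - {..s} = {s<..}" by auto
  ultimately show ?thesis using True by simp
next
  case False
  then have "exponential_density a x \<le> 0" for x
    by (simp add: exponential_density_def mult_nonpos_nonneg)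
  then have "(\<lambda>x. ennreal (exponential_density a x)) = (\<lambda>x. 0)"
    by (intro ext) (simp add: ennreal_neg)
  then show ?thesis using False by (simp add: measure_def emeasure_density)
qed

lemma integral_exponential_density:
  assumes "l > 0"
  shows "(\<integral>x. exponential_density l x \<partial>lborel) = 1"
proof -
  interpret P: prob_space "density lborel (\<lambda>x. ennreal (exponential_density l x))"
    by (rule prob_space_exponential_density[OF assms])
  show ?thesis
    using P.prob_space assms
      integral_density[of "\<lambda>_. 1 :: real" "lborel :: real measure" "exponential_density l"]
    by (simp add: exponential_density_nonneg)
qed

text \<open>
  The tower property reduces the tail to the mean of \<open>exp (- \<alpha> * s)\<close> over the exponentially distributed
  rate \<open>\<alpha>\<close>, the Laplace transform \<open>(1 / l) / (1 / l + s)\<close>.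
\<close>

lemma gcp_interarrival_tail:
  assumes "prob_space M" and l: "l > 0" and gcp: "gcp_interarrivals M l D" and s: "s \<ge> 0"
  shows "measure M {\<omega> \<in> space M. D 1 \<omega> > s} = 1 / (1 + l * s)"
proof -
  interpret prob_space M by fact
  obtain \<alpha> where \<alpha>: "distributed M lborel \<alpha> (\<lambda>x. ennreal (exponential_density (1 / l) x))"
    and cond: "\<forall>J B. finite J \<and> J \<subseteq> {1..} \<and> (\<forall>k\<in>J. B k \<in> sets borel) \<longrightarrow>
      (AE \<omega> in M. real_cond_exp M (vimage_algebra (space M) \<alpha> borel)
        (indicator {\<omega> \<in> space M. \<forall>k\<in>J. D k \<omega> \<in> B k}) \<omega> =
        (\<Prod>k\<in>J. measure (density lborel (\<lambda>x. ennreal (exponential_density (\<alpha> \<omega>) x))) (B k)))"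
    using gcp unfolding gcp_interarrivals_def by (elim conjE exE) (rule that)
  have [measurable]: "D 1 \<in> borel_measurable M"
    using gcp by (simp add: gcp_interarrivals_def)
  have [measurable]: "\<alpha> \<in> borel_measurable M"
    using distributed_measurable[OF \<alpha>] by simp
  let ?F = "vimage_algebra (space M) \<alpha> borel"
  let ?A = "{\<omega> \<in> space M. D 1 \<omega> > s}"
  let ?g = "\<lambda>a. if a > 0 then exp (- a * s) else 0"
  have "subalgebra M ?F"
    unfolding subalgebra_def by (auto intro: sets_image_in_sets[THEN subsetD, rotated 2])
  then interpret F: sigma_finite_subalgebra M ?F
    by (intro finite_measure_subalgebra_is_sigma_finite finite_measure_subalgebra.intro
      finite_measure_subalgebra_axioms.intro) unfold_locales
  have A: "?A \<in> sets M" by measurable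
  have AE: "AE \<omega> in M. real_cond_exp M ?F (indicator ?A) \<omega> = ?g (\<alpha> \<omega>)"
    using cond[rule_format, of "{1}" "\<lambda>_. {s<..}"] s by (simp add: exponential_law_tail)
  have "measure M ?A = (\<integral>\<omega>. indicator ?A \<omega> \<partial>M)"
    using A by simp
  also have "\<dots> = (\<integral>\<omega>. real_cond_exp M ?F (indicator ?A) \<omega> \<partial>M)"
    using A by (intro F.real_cond_exp_int(2)[symmetric]) (simp add: emeasure_eq_measure)
  also have "\<dots> = (\<integral>\<omega>. ?g (\<alpha> \<omega>) \<partial>M)"
    by (intro integral_cong_AE AE) auto
  also have "\<dots> = (\<integral>a. exponential_density (1 / l) a * ?g a \<partial>lborel)"
    using l by (intro distributed_integral[OF \<alpha>, symmetric] exponential_density_nonneg) auto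
  \<comment> \<open>Exponential tilting: the integrand is a multiple of the exponential density with rate \<open>1 / l + s\<close>, except at \<open>0\<close>.\<close>
  also have "\<dots> = (\<integral>a. 1 / (1 + l * s) * exponential_density (1 / l + s) a \<partial>lborel)"
  proof (rule integral_cong_AE)
    have "l * s \<ge> 0" using l s by simp
    then have pos: "1 + l * s > 0" by linarith
    have neq: "exponential_density (1 / l) a * ?g a = 1 / (1 + l * s) * exponential_density (1 / l + s) a"
      if "a \<noteq> 0" for a
    proof (cases "a > 0")
      case True
      have "1 / (1 + l * s) * (1 / l + s) = 1 / l"
        using l pos by (simp add: field_simps)
      then have "1 / (1 + l * s) * ((1 / l + s) * exp (- a * (1 / l + s))) =
          1 / l * exp (- a * (1 / l) + - a * s)"
        by (simp only: mult.assoc[symmetric] distrib_left)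
      then show ?thesis
        using True by (simp only: exponential_density_def exp_add) simp
    next
      case False
      then show ?thesis using that by (simp add: exponential_density_def)
    qed
    show "AE a in lborel. exponential_density (1 / l) a * ?g a =
        1 / (1 + l * s) * exponential_density (1 / l + s) a"
      by (rule eventually_mono[OF AE_lborel_singleton[of 0] neq])
  qed auto
  also have "\<dots> = 1 / (1 + l * s)"
    using l s by (subst integral_mult_right_zero) (simp add: integral_exponential_density add_pos_nonneg)
  finally show ?thesis .
qed

lemma gcp_interarrival_pos:
  assumes "prob_space M" "l > 0" and gcp: "gcp_interarrivals M l D"
  shows "AE \<omega> in M. D 1 \<omega> > 0"
proof -
  interpret prob_space M by fact
  have "D 1 \<in> borel_measurable M"
    using gcp by (simp add: gcp_interarrivals_def)
  then show ?thesis
    using gcp_interarrival_tail[OF assms, of 0] by (subst prob_Collect_eq_1[symmetric]) auto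
qed

lemma gcp_interarrival_distributed:
  assumes "prob_space M" and l: "l > 0" and gcp: "gcp_interarrivals M l D"
  shows "distributed M lborel (D 1) (gcp_density l)"
proof (rule distributedI_borel_atMost[where g = "\<lambda>a. if a < 0 then 0 else 1 - 1 / (1 + l * a)"])
  interpret prob_space M by fact
  show D [measurable]: "D 1 \<in> borel_measurable M"
    using gcp by (simp add: gcp_interarrivals_def)
  show "AE x in lborel. 0 \<le> gcp_density l x"
    using l by (simp add: gcp_density_nonneg)
  let ?cdf = "\<lambda>a. if a < 0 then 0 else 1 - 1 / (1 + l * a)"
  fix a :: real
  show "(\<integral>\<^sup>+x. ennreal (gcp_density l x * indicator {..a} x) \<partial>lborel) = ennreal (?cdf a)"
  proof (cases "a < 0")
    case True
    then have "(\<integral>\<^sup>+x. ennreal (gcp_density l x * indicator {..a} x) \<partial>lborel) = (\<integral>\<^sup>+(x::real). 0 \<partial>lborel)"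
      by (intro nn_integral_cong) (auto simp: gcp_density_def indicator_def)
    then show ?thesis using True by simp
  next
    case False
    have "(\<integral>\<^sup>+x. ennreal (gcp_density l x * indicator {..a} x) \<partial>lborel) =
        (\<integral>\<^sup>+x. ennreal (l / (1 + l * x)\<^sup>2) * indicator {0..a} x \<partial>lborel)"
      by (intro nn_integral_cong) (auto simp: gcp_density_def indicator_def)
    also have "\<dots> = ennreal (- 1 / (1 + l * a) - - 1 / (1 + l * 0))"
    proof (rule nn_integral_FTC_Icc[where F = "\<lambda>x. - 1 / (1 + l * x)"])
      fix x assume "x \<in> {0..a}"
      then have "1 + l * x > 0" using l by (simp add: add_pos_nonneg)
      then show "((\<lambda>x. - 1 / (1 + l * x)) has_real_derivative l / (1 + l * x)\<^sup>2) (at x)"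
        by (auto intro!: derivative_eq_intros simp: power2_eq_square)
    qed (use False l in auto)
    finally show ?thesis using False by simp
  qed
  have compl: "measure M {\<omega> \<in> space M. D 1 \<omega> \<le> b} = 1 - 1 / (1 + l * b)" if "b \<ge> 0" for b
  proof -
    have "{\<omega> \<in> space M. D 1 \<omega> \<le> b} = space M - {\<omega> \<in> space M. D 1 \<omega> > b}" by auto
    moreover have "{\<omega> \<in> space M. D 1 \<omega> > b} \<in> events" by measurable
    ultimately show ?thesis
      using gcp_interarrival_tail[OF assms that] by (simp only: prob_compl)
  qed
  show "emeasure M {\<omega> \<in> space M. D 1 \<omega> \<le> a} = ennreal (?cdf a)"
  proof (cases "a < 0")
    case True
    have "AE \<omega> in M. \<not> D 1 \<omega> \<le> a"
      using gcp_interarrival_pos[OF assms] True by (auto elim: eventually_mono)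
    then show ?thesis
      using True by (simp add: emeasure_eq_0_AE)
  next
    case False
    then show ?thesis
      using compl[of a] by (simp add: emeasure_eq_measure)
  qed
qed simp

text \<open>
  Disintegration along the first of two independent variables.  Independence is stated as a product
  law, because \<open>indep_var\<close> needs both variables to have the same type, whereas \<open>Y\<close> will be a pair.
\<close>

lemma (in prob_space) emeasure_indep_pair:
  assumes X: "distributed M lborel X f" and Y: "Y \<in> M \<rightarrow>\<^sub>M N"
    and XY: "distr M lborel X \<Otimes>\<^sub>M distr M N Y = distr M (lborel \<Otimes>\<^sub>M N) (\<lambda>\<omega>. (X \<omega>, Y \<omega>))"
    and A: "A \<in> sets (lborel \<Otimes>\<^sub>M N)"
  shows "emeasure M {\<omega> \<in> space M. (X \<omega>, Y \<omega>) \<in> A} =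
    (\<integral>\<^sup>+x. f x * emeasure M {\<omega> \<in> space M. (x, Y \<omega>) \<in> A} \<partial>lborel)"
proof -
  have [measurable]: "X \<in> M \<rightarrow>\<^sub>M lborel" "Y \<in> M \<rightarrow>\<^sub>M N" "f \<in> borel_measurable lborel"
    using Y distributed_measurable[OF X] distributed_borel_measurable[OF X] by auto
  interpret Y: prob_space "distr M N Y" by (rule prob_space_distr) simp
  note [measurable] = A
  have sl: "Y -` (Pair x -` A) \<inter> space M = {\<omega> \<in> space M. (x, Y \<omega>) \<in> A}" for x by auto
  have A': "A \<in> sets (distr M lborel X \<Otimes>\<^sub>M distr M N Y)"
    using A by (simp only: sets_pair_measure_cong[OF sets_distr sets_distr])
  have "emeasure M {\<omega> \<in> space M. (X \<omega>, Y \<omega>) \<in> A} =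
      emeasure (distr M (lborel \<Otimes>\<^sub>M N) (\<lambda>\<omega>. (X \<omega>, Y \<omega>))) A"
    using A by (subst emeasure_distr) (auto intro!: arg_cong[where f = "emeasure M"])
  also have "\<dots> = emeasure (distr M lborel X \<Otimes>\<^sub>M distr M N Y) A"
    using XY by simp
  also have "\<dots> = (\<integral>\<^sup>+x. emeasure (distr M N Y) (Pair x -` A) \<partial>distr M lborel X)"
    by (rule Y.emeasure_pair_measure_alt[OF A'])
  also have "\<dots> = (\<integral>\<^sup>+x. emeasure M {\<omega> \<in> space M. (x, Y \<omega>) \<in> A} \<partial>density lborel f)"
    by (subst distributed_distr_eq_density[OF X])
      (auto intro!: nn_integral_cong simp: emeasure_distr sets_Pair1[OF A] sl)
  also have "\<dots> = (\<integral>\<^sup>+x. f x * emeasure M {\<omega> \<in> space M. (x, Y \<omega>) \<in> A} \<partial>lborel)"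
  proof (rule nn_integral_density)
    have "(\<lambda>x. emeasure (distr M N Y) (Pair x -` A)) \<in> borel_measurable lborel"
      using Y.measurable_emeasure_Pair[of A lborel] A by (simp cong: sets_pair_measure_cong)
    then show "(\<lambda>x. emeasure M {\<omega> \<in> space M. (x, Y \<omega>) \<in> A}) \<in> borel_measurable lborel"
      by (simp add: emeasure_distr sets_Pair1[OF A] sl)
  qed simp
  finally show ?thesis .
qed

text \<open>
  The probability that the second of two consecutive independent sojourns, with intensities \<open>a\<close> and
  \<open>b\<close>, is under way at time \<open>t\<close>.
\<close>

definition second_sojourn_prob :: "real \<Rightarrow> real \<Rightarrow> real \<Rightarrow> real" where
  "second_sojourn_prob a b t = a / (a + b + a * b * t)\<^sup>2 *
     (a * t * (a + b + a * b * t) / (1 + a * t) + b * ln ((1 + a * t) * (1 + b * t)))"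

text \<open>
  With \<open>p = 1 + a * s\<close> and \<open>q = 1 + b * (t - s)\<close> the quantity \<open>b * p + a * q = K\<close> does not depend on \<open>s\<close>, so
  \<open>1 / (p * q) = (b / q + a / p) / K\<close>, and using this twice splits \<open>1 / (p\<^sup>2 * q)\<close> into partial fractions.
\<close>

lemma nn_integral_second_sojourn:
  assumes ab: "a > 0" "b > 0" and t: "t \<ge> 0"
  shows "(\<integral>\<^sup>+s. ennreal (a / (1 + a * s)\<^sup>2 * (1 / (1 + b * (t - s)))) * indicator {0..t} s \<partial>lborel) =
    ennreal (second_sojourn_prob a b t)"
proof -
  define K where "K = a + b + a * b * t"
  have K: "K > 0" using ab t by (simp add: K_def add_pos_nonneg)
  let ?F = "\<lambda>s. a * (b / K\<^sup>2 * (ln (1 + a * s) - ln (1 + b * (t - s))) - 1 / ((1 + a * s) * K))"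
  have "(\<integral>\<^sup>+s. ennreal (a / (1 + a * s)\<^sup>2 * (1 / (1 + b * (t - s)))) * indicator {0..t} s \<partial>lborel) =
      ennreal (?F t - ?F 0)"
  proof (rule nn_integral_FTC_Icc)
    fix s assume "s \<in> {0..t}"
    then have pq: "1 + a * s > 0" "1 + b * (t - s) > 0"
      using ab by (simp_all add: add_pos_nonneg)
    define p q where "p = 1 + a * s" and "q = 1 + b * (t - s)"
    have Kpq: "K = b * p + a * q"
      by (simp add: K_def p_def q_def algebra_simps)
    have nz: "p \<noteq> 0" "q \<noteq> 0" "K \<noteq> 0" using pq K by (auto simp: p_def q_def)
    have "((\<lambda>s. ln (1 + a * s)) has_real_derivative a / p) (at s)"
      "((\<lambda>s. ln (1 + b * (t - s))) has_real_derivative - b / q) (at s)"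
      "((\<lambda>s. 1 / ((1 + a * s) * K)) has_real_derivative - a / (p\<^sup>2 * K)) (at s)"
      unfolding p_def q_def using pq K
      by (auto intro!: derivative_eq_intros simp: power2_eq_square)
    note this [derivative_intros]
    have "(?F has_real_derivative a * (b * (a / p + b / q) / K\<^sup>2 + a / (p\<^sup>2 * K))) (at s)"
      by (rule derivative_eq_intros refl)+ simp
    also have "a * (b * (a / p + b / q) / K\<^sup>2 + a / (p\<^sup>2 * K)) = a / p\<^sup>2 * (1 / q)"
    proof -
      have "a / p + b / q = K / (p * q)"
        using nz by (simp add: Kpq field_simps)
      then have "b * (a / p + b / q) / K\<^sup>2 + a / (p\<^sup>2 * K) = b / (p * q * K) + a / (p\<^sup>2 * K)"
        using nz by (simp add: power2_eq_square)
      also have "\<dots> = (b * p + a * q) / (p\<^sup>2 * q * K)"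
        using nz by (simp add: field_simps power2_eq_square)
      also have "\<dots> = 1 / (p\<^sup>2 * q)"
        unfolding Kpq[symmetric] using nz by simp
      finally show ?thesis by simp
    qed
    finally show "(?F has_real_derivative a / (1 + a * s)\<^sup>2 * (1 / (1 + b * (t - s)))) (at s)"
      by (simp add: p_def q_def)
    show "0 \<le> a / (1 + a * s)\<^sup>2 * (1 / (1 + b * (t - s)))"
      using pq ab by simp
  qed (use t in auto)
  also have "?F t - ?F 0 = second_sojourn_prob a b t"
  proof -
    have pos: "1 + a * t > 0" "1 + b * t > 0" using ab t by (simp_all add: add_pos_nonneg)
    have "a / K - a / ((1 + a * t) * K) = a / K\<^sup>2 * (a * t * K / (1 + a * t))"
    proof -
      have "a / K - a / (r * K) = a / K\<^sup>2 * ((r - 1) * K / r)" if "r \<noteq> 0" for r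
        using that K by (simp add: field_simps power2_eq_square)
      from this[of "1 + a * t"] show ?thesis using pos by simp
    qed
    moreover have "ln ((1 + a * t) * (1 + b * t)) = ln (1 + a * t) + ln (1 + b * t)"
      using pos by (simp add: ln_mult)
    ultimately show ?thesis
      unfolding second_sojourn_prob_def K_def[symmetric] by (simp add: algebra_simps)
  qed
  finally show ?thesis .
qed

context prob_space
begin

lemma emeasure_second_sojourn:
  assumes ab: "a > 0" "b > 0"
    and X: "gcp_interarrivals M a X" and Y: "gcp_interarrivals M b Y"
    and XY: "distr M lborel (X 1) \<Otimes>\<^sub>M distr M borel (Y 1) =
      distr M (lborel \<Otimes>\<^sub>M borel) (\<lambda>\<omega>. (X 1 \<omega>, Y 1 \<omega>))" and t: "t \<ge> 0"
  shows "emeasure M {\<omega> \<in> space M. X 1 \<omega> \<le> t \<and> t < X 1 \<omega> + Y 1 \<omega>} =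
    ennreal (second_sojourn_prob a b t)"
proof -
  have Y': "Y 1 \<in> borel_measurable M"
    using Y by (simp add: gcp_interarrivals_def)
  let ?A = "{(x, y). x \<le> t \<and> t < x + y} :: (real \<times> real) set"
  have "{z \<in> space (borel \<Otimes>\<^sub>M borel). fst z \<le> t \<and> t < fst z + snd z} \<in>
      sets (borel \<Otimes>\<^sub>M borel :: (real \<times> real) measure)"
    by measurable
  then have "?A \<in> sets (borel \<Otimes>\<^sub>M borel)"
    by (simp add: space_pair_measure case_prod_beta')
  then have A: "?A \<in> sets (lborel \<Otimes>\<^sub>M borel)" by (simp cong: sets_pair_measure_cong)
  have "emeasure M {\<omega> \<in> space M. (X 1 \<omega>, Y 1 \<omega>) \<in> ?A} =
    (\<integral>\<^sup>+x. gcp_density a x * emeasure M {\<omega> \<in> space M. (x, Y 1 \<omega>) \<in> ?A} \<partial>lborel)"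
    using gcp_interarrival_distributed[OF _ ab(1) X] prob_space_axioms
    by (intro emeasure_indep_pair[OF _ Y' XY A]) auto
  also have "\<dots> = (\<integral>\<^sup>+s. ennreal (a / (1 + a * s)\<^sup>2 * (1 / (1 + b * (t - s)))) * indicator {0..t} s \<partial>lborel)"
  proof (rule nn_integral_cong)
    fix x :: real
    consider "x < 0" | "x > t" | "0 \<le> x" "x \<le> t" by linarith
    then show "ennreal (gcp_density a x) * emeasure M {\<omega> \<in> space M. (x, Y 1 \<omega>) \<in> ?A} =
        ennreal (a / (1 + a * x)\<^sup>2 * (1 / (1 + b * (t - x)))) * indicator {0..t} x"
    proof cases
      case 3
      have "{\<omega> \<in> space M. (x, Y 1 \<omega>) \<in> ?A} = {\<omega> \<in> space M. Y 1 \<omega> > t - x}"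
        using 3 by auto
      then have "emeasure M {\<omega> \<in> space M. (x, Y 1 \<omega>) \<in> ?A} = ennreal (1 / (1 + b * (t - x)))"
        using gcp_interarrival_tail[OF _ ab(2) Y, of "t - x"] 3 prob_space_axioms
        by (simp add: emeasure_eq_measure)
      moreover have "0 \<le> 1 / (1 + b * (t - x))"
        using ab 3 by simp
      ultimately show ?thesis
        using 3 ab by (simp add: gcp_density_def ennreal_mult[symmetric] )
    qed (simp_all add: gcp_density_def)
  qed
  also have "\<dots> = ennreal (second_sojourn_prob a b t)"
    by (rule nn_integral_second_sojourn[OF ab t])
  finally show ?thesis by simp
qed

lemma emeasure_third_sojourn:
  assumes abl: "a > 0" "b > 0" "d > 0"
    and X: "gcp_interarrivals M a X" and Y: "gcp_interarrivals M b Y" and Z: "gcp_interarrivals M d Z"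
    and XYZ: "distr M lborel (X 1) \<Otimes>\<^sub>M distr M (borel \<Otimes>\<^sub>M borel) (\<lambda>\<omega>. (Y 1 \<omega>, Z 1 \<omega>)) =
      distr M (lborel \<Otimes>\<^sub>M (borel \<Otimes>\<^sub>M borel)) (\<lambda>\<omega>. (X 1 \<omega>, (Y 1 \<omega>, Z 1 \<omega>)))"
    and YZ: "distr M lborel (Y 1) \<Otimes>\<^sub>M distr M borel (Z 1) =
      distr M (lborel \<Otimes>\<^sub>M borel) (\<lambda>\<omega>. (Y 1 \<omega>, Z 1 \<omega>))"
    and t: "t \<ge> 0"
  shows "emeasure M {\<omega> \<in> space M. X 1 \<omega> + Y 1 \<omega> \<le> t \<and> t < X 1 \<omega> + Y 1 \<omega> + Z 1 \<omega>} =
    (\<integral>\<^sup>+s. ennreal (a / (1 + a * s)\<^sup>2 * second_sojourn_prob b d (t - s)) * indicator {0..t} s \<partial>lborel)"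
proof -
  have [measurable]: "Y 1 \<in> borel_measurable M" "Z 1 \<in> borel_measurable M"
    using Y Z by (simp_all add: gcp_interarrivals_def)
  have YZ': "(\<lambda>\<omega>. (Y 1 \<omega>, Z 1 \<omega>)) \<in> M \<rightarrow>\<^sub>M borel \<Otimes>\<^sub>M borel" by measurable
  let ?A = "{(x, y, z). x + y \<le> t \<and> t < x + y + z} :: (real \<times> real \<times> real) set"
  have "{z \<in> space (borel \<Otimes>\<^sub>M (borel \<Otimes>\<^sub>M borel)).
      fst z + fst (snd z) \<le> t \<and> t < fst z + fst (snd z) + snd (snd z)} \<in>
      sets (borel \<Otimes>\<^sub>M (borel \<Otimes>\<^sub>M borel) :: (real \<times> real \<times> real) measure)"
    by measurable
  then have "?A \<in> sets (borel \<Otimes>\<^sub>M (borel \<Otimes>\<^sub>M borel))"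
    by (simp add: space_pair_measure case_prod_beta')
  then have A: "?A \<in> sets (lborel \<Otimes>\<^sub>M (borel \<Otimes>\<^sub>M borel))" by (simp cong: sets_pair_measure_cong)
  have "emeasure M {\<omega> \<in> space M. (X 1 \<omega>, (Y 1 \<omega>, Z 1 \<omega>)) \<in> ?A} =
    (\<integral>\<^sup>+x. gcp_density a x * emeasure M {\<omega> \<in> space M. (x, (Y 1 \<omega>, Z 1 \<omega>)) \<in> ?A} \<partial>lborel)"
    using gcp_interarrival_distributed[OF _ abl(1) X] prob_space_axioms
    by (intro emeasure_indep_pair[OF _ YZ' XYZ A]) auto
  also have "\<dots> = (\<integral>\<^sup>+s. ennreal (a / (1 + a * s)\<^sup>2 * second_sojourn_prob b d (t - s)) * indicator {0..t} s \<partial>lborel)"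
  proof (rule nn_integral_cong)
    fix x :: real
    consider "x < 0" | "x > t" | "0 \<le> x" "x \<le> t" by linarith
    then show "ennreal (gcp_density a x) * emeasure M {\<omega> \<in> space M. (x, (Y 1 \<omega>, Z 1 \<omega>)) \<in> ?A} =
        ennreal (a / (1 + a * x)\<^sup>2 * second_sojourn_prob b d (t - x)) * indicator {0..t} x"
    proof cases
      case 2
      have "AE \<omega> in M. Y 1 \<omega> > 0"
        using gcp_interarrival_pos[OF _ abl(2) Y] prob_space_axioms by simp
      then have "AE \<omega> in M. \<not> (x + Y 1 \<omega> \<le> t \<and> t < x + Y 1 \<omega> + Z 1 \<omega>)"
        using 2 by (auto elim!: eventually_mono)
      then have "emeasure M {\<omega> \<in> space M. (x, (Y 1 \<omega>, Z 1 \<omega>)) \<in> ?A} = 0"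
        by (intro emeasure_eq_0_AE) simp
      then show ?thesis using 2 by simp
    next
      case 3
      have "{\<omega> \<in> space M. (x, (Y 1 \<omega>, Z 1 \<omega>)) \<in> ?A} =
          {\<omega> \<in> space M. Y 1 \<omega> \<le> t - x \<and> t - x < Y 1 \<omega> + Z 1 \<omega>}"
        by auto
      then have "emeasure M {\<omega> \<in> space M. (x, (Y 1 \<omega>, Z 1 \<omega>)) \<in> ?A} =
          ennreal (second_sojourn_prob b d (t - x))"
        using emeasure_second_sojourn[OF abl(2,3) Y Z YZ, of "t - x"] 3 by simp
      moreover have "ennreal (a / (1 + a * x)\<^sup>2 * second_sojourn_prob b d (t - x)) =
          ennreal (a / (1 + a * x)\<^sup>2) * ennreal (second_sojourn_prob b d (t - x))"
        using abl by (intro ennreal_mult') simp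
      ultimately show ?thesis
        using 3 by (simp only: gcp_density_def) simp
    qed (simp add: gcp_density_def)
  qed
  finally show ?thesis by (simp add: add.assoc)
qed

end

section \<open>The dilogarithm\<close>

text \<open>
  The continuous extension of the integrand to \<open>0\<close>, where division by zero would give the value \<open>0\<close>.
\<close>

definition dilog_integrand :: "real \<Rightarrow> real" where
  "dilog_integrand u = (if u = 0 then 1 else - ln (1 - u) / u)"

lemma isCont_dilog_integrand:
  assumes "u < 1"
  shows "isCont dilog_integrand u"
proof (cases "u = 0")
  case True
  have "((\<lambda>u :: real. - ln (1 - u)) has_real_derivative 1) (at 0)"
    by (auto intro!: derivative_eq_intros)
  then have "((\<lambda>u :: real. - ln (1 - u) / u) \<longlongrightarrow> 1) (at 0)"
    by (simp add: has_field_derivative_iff)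
  then have "(dilog_integrand \<longlongrightarrow> 1) (at 0)"
    by (rule Lim_transform_eventually) (auto simp: dilog_integrand_def eventually_at_filter)
  then show ?thesis
    using True by (simp add: isCont_def dilog_integrand_def)
next
  case False
  have "\<forall>\<^sub>F v in nhds u. v \<noteq> 0"
    using False by (rule t1_space_nhds)
  then have "isCont dilog_integrand u \<longleftrightarrow> isCont (\<lambda>v. - ln (1 - v) / v) u"
    by (intro isCont_cong) (auto elim!: eventually_mono simp: dilog_integrand_def)
  also have "isCont (\<lambda>v. - ln (1 - v) / v) u"
    using assms False by (intro continuous_intros) auto
  finally show ?thesis .
qed

lemma dilog_eq: "dilog z = (LBINT u=ereal 0..ereal z. dilog_integrand u)"
proof -
  have "dilog z = (LBINT u=ereal 0..ereal z. - (ln (1 - u) / u))"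
    by (simp add: dilog_def interval_lebesgue_integral_uminus)
  also have "\<dots> = (LBINT u=ereal 0..ereal z. dilog_integrand u)"
    by (rule interval_integral_discrete_difference[of "{0}"]) (auto simp: dilog_integrand_def)
  finally show ?thesis .
qed

lemma dilog_0 [simp]: "dilog 0 = 0"
  by (simp add: dilog_def)

lemma DERIV_dilog:
  assumes "z < 1"
  shows "(dilog has_real_derivative dilog_integrand z) (at z)"
proof -
  define a b where "a = min z 0 - 1" and "b = (max z 0 + 1) / 2"
  have ab: "a < z" "a < 0" "z < b" "0 < b" "b < 1"
    using assms by (auto simp: a_def b_def min_def max_def field_simps)
  have "continuous_on {a..b} dilog_integrand"
    using ab by (intro continuous_at_imp_continuous_on ballI isCont_dilog_integrand) auto
  then have "((\<lambda>u. LBINT y=ereal 0..ereal u. dilog_integrand y) has_vector_derivative dilog_integrand z)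
      (at z within {a..b})"
    using ab by (intro interval_integral_FTC2) auto
  then have "(dilog has_real_derivative dilog_integrand z) (at z within {a..b})"
    by (simp add: has_real_derivative_iff_has_vector_derivative dilog_eq[abs_def])
  then show ?thesis
    using ab by (simp add: at_within_Icc_at)
qed

definition dilog_series :: "real \<Rightarrow> real" where
  "dilog_series z = (\<Sum>n. 1 / (real n)\<^sup>2 * z ^ n)"

lemma summable_inverse_squares: "summable (\<lambda>n. 1 / (real n)\<^sup>2)"
  using inverse_power_summable[of 2, where ?'a = real] by (simp add: field_simps)

lemma continuous_on_dilog_series: "continuous_on {-1..1} dilog_series"
proof (rule uniform_limit_theorem)
  show "uniform_limit {-1..1} (\<lambda>n z. \<Sum>i<n. 1 / (real i)\<^sup>2 * z ^ i) dilog_series sequentially"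
    unfolding dilog_series_def[abs_def]
  proof (rule Weierstrass_m_test[OF _ summable_inverse_squares])
    fix n :: nat and z :: real assume "z \<in> {-1..1}"
    then have "\<bar>z\<bar> ^ n \<le> 1" by (intro power_le_one) auto
    then show "norm (1 / (real n)\<^sup>2 * z ^ n) \<le> 1 / (real n)\<^sup>2"
      by (simp add: abs_mult power_abs divide_right_mono)
  qed
  show "\<forall>\<^sub>F n in sequentially. continuous_on {-1..1} (\<lambda>z :: real. \<Sum>i<n. 1 / (real i)\<^sup>2 * z ^ i)"
    by (intro always_eventually allI continuous_intros)
qed simp

lemma DERIV_dilog_series:
  assumes "\<bar>z\<bar> < 1"
  shows "(dilog_series has_real_derivative dilog_integrand z) (at z)"
proof -
  have "((\<lambda>z. \<Sum>n. 1 / (real n)\<^sup>2 * z ^ n) has_real_derivative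
      (\<Sum>n. diffs (\<lambda>n. 1 / (real n)\<^sup>2) n * z ^ n)) (at z)"
    using assms summable_inverse_squares by (intro termdiffs_strong[where K = 1]) auto
  also have "(\<lambda>n. diffs (\<lambda>n. 1 / (real n)\<^sup>2) n * z ^ n) = (\<lambda>n. 1 / real (Suc n) * z ^ n)"
    by (intro ext) (simp add: diffs_def power2_eq_square)
  also have "(\<Sum>n. 1 / real (Suc n) * z ^ n) = dilog_integrand z"
  proof (cases "z = 0")
    case True
    then show ?thesis
      using suminf_finite[of "{0}" "\<lambda>n. 1 / real (Suc n) * z ^ n"] by (simp add: dilog_integrand_def)
  next
    case False
    let ?f = "\<lambda>n. 1 / real (Suc n) * z ^ n"
    have eq: "(- 1) ^ n * (1 / real (n + 1)) * ((1 - z) - 1) ^ Suc n = - z * ?f n" for n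
    proof -
      have "(- 1) ^ n * (- z) ^ Suc n = - (z ^ Suc n)"
        by (simp add: power_minus[of z] flip: power_add mult_2)
      then show ?thesis by (simp add: field_simps)
    qed
    have "summable ?f"
    proof (rule summable_comparison_test')
      show "summable (\<lambda>n. \<bar>z\<bar> ^ n)"
        using assms by (intro summable_geometric) simp
      show "norm (?f n) \<le> \<bar>z\<bar> ^ n" for n
        by (simp add: abs_mult power_abs field_simps mult_left_le)
    qed
    then have "ln (1 - z) = - z * (\<Sum>n. ?f n)"
      using ln_series[of "1 - z"] assms unfolding eq by (subst suminf_mult[symmetric]) auto
    then show ?thesis
      using False by (simp add: dilog_integrand_def)
  qed
  finally show ?thesis by (simp add: dilog_series_def[abs_def])
qed

text \<open>
  Both sides vanish at \<open>0\<close> and have the same derivative in \<open>{-1<..<1}\<close>; continuity extends the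
  equality to \<open>-1\<close>.
\<close>

lemma dilog_eq_series:
  assumes "-1 \<le> z" "z < 1"
  shows "dilog z = dilog_series z"
proof -
  have const: "dilog b - dilog_series b = dilog a - dilog_series a" if "-1 \<le> a" "a < b" "b < 1" for a b
  proof (rule DERIV_isconst_end[OF that(2)])
    have "continuous_on {a..b} dilog"
      using that by (intro continuous_at_imp_continuous_on ballI DERIV_isCont[OF DERIV_dilog]) auto
    then show "continuous_on {a..b} (\<lambda>z. dilog z - dilog_series z)"
      using that by (intro continuous_on_diff continuous_on_subset[OF continuous_on_dilog_series]) auto
    show "((\<lambda>z. dilog z - dilog_series z) has_real_derivative 0) (at x)" if "a < x" "x < b" for x
      using DERIV_diff[OF DERIV_dilog DERIV_dilog_series, of x] that \<open>-1 \<le> a\<close> \<open>b < 1\<close> by simp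
  qed
  have "dilog_series 0 = 0"
    using suminf_finite[of "{0}" "\<lambda>n. 1 / (real n)\<^sup>2 * 0 ^ n"] by (simp add: dilog_series_def)
  then show ?thesis
    using const[of 0 z] const[of z 0] assms by (cases "z = 0"; cases "z > 0") auto
qed

lemma dilog_series_1: "dilog_series 1 = pi\<^sup>2 / 6"
proof -
  have "(\<lambda>n. 1 / (real (Suc n))\<^sup>2) sums (pi\<^sup>2 / 6)"
    using inverse_squares_sums by simp
  then have "(\<lambda>n. 1 / (real n)\<^sup>2) sums (pi\<^sup>2 / 6)"
    by (subst (asm) sums_Suc_iff) simp
  then show ?thesis
    by (simp add: dilog_series_def sums_unique[symmetric])
qed

text \<open>
  In \<open>1 / n\<^sup>2 + (-1)\<^sup>n / n\<^sup>2\<close> only the even \<open>n\<close> survive, and they sum to half of \<open>\<pi>\<^sup>2 / 6\<close>.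
\<close>

lemma dilog_minus_1: "dilog (- 1) = - pi\<^sup>2 / 12"
proof -
  have sq: "(\<lambda>n. 1 / (real (Suc n))\<^sup>2) sums (pi\<^sup>2 / 6)"
    using inverse_squares_sums by simp
  have "(\<lambda>n. if even n then 0 else 1 / 2 * (1 / (real (Suc ((n - 1) div 2)))\<^sup>2)) sums (1 / 2 * (pi\<^sup>2 / 6))"
    by (intro sums_if' sums_mult sq)
  then have "(\<lambda>n. (if even n then 0 else 1 / 2 * (1 / (real (Suc ((n - 1) div 2)))\<^sup>2)) -
      1 / (real (Suc n))\<^sup>2) sums (1 / 2 * (pi\<^sup>2 / 6) - pi\<^sup>2 / 6)"
    by (intro sums_diff sq)
  also have "(\<lambda>n. (if even n then 0 else 1 / 2 * (1 / (real (Suc ((n - 1) div 2)))\<^sup>2)) -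
      1 / (real (Suc n))\<^sup>2) = (\<lambda>n. 1 / (real (Suc n))\<^sup>2 * (- 1) ^ Suc n)"
  proof
    fix n :: nat
    show "(if even n then 0 else 1 / 2 * (1 / (real (Suc ((n - 1) div 2)))\<^sup>2)) - 1 / (real (Suc n))\<^sup>2 =
        1 / (real (Suc n))\<^sup>2 * (- 1) ^ Suc n"
    proof (cases "even n")
      case False
      then obtain k where n: "n = 2 * k + 1" by (elim oddE)
      have "real (Suc n) = 2 * real (Suc k)" by (simp add: n)
      moreover have "(n - 1) div 2 = k" by (simp add: n)
      ultimately show ?thesis
        using False by (simp only: power_mult_distrib) (simp add: field_simps del: of_nat_Suc)
    qed simp
  qed
  finally have "(\<lambda>n. 1 / (real n)\<^sup>2 * (- 1) ^ n) sums (1 / 2 * (pi\<^sup>2 / 6) - pi\<^sup>2 / 6)"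
    by (subst (asm) sums_Suc_iff) simp
  then show ?thesis
    by (simp add: dilog_eq_series dilog_series_def sums_unique[symmetric])
qed

text \<open>
  The derivative of \<open>Li\<^sub>2(x) + Li\<^sub>2(1 - x) + ln x * ln (1 - x)\<close> is zero, so this function is constant on
  \<open>{0<..<1}\<close>.  Its limit at \<open>0\<close> is \<open>Li\<^sub>2(1)\<close>, the Basel sum; working with the series instead of the
  integral gives the continuity at \<open>1\<close>.
\<close>

lemma dilog_reflection:
  assumes "0 < z" "z < 1"
  shows "dilog z + dilog (1 - z) = pi\<^sup>2 / 6 - ln z * ln (1 - z)"
proof -
  let ?G = "\<lambda>x. dilog_series x + dilog_series (1 - x) + ln x * ln (1 - x)"
  have deriv: "(?G has_real_derivative 0) (at x)" if "0 < x" "x < 1" for x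
  proof -
    have "(dilog_series has_real_derivative - ln (1 - x) / x) (at x)"
      "(dilog_series has_real_derivative - ln x / (1 - x)) (at (1 - x))"
      using DERIV_dilog_series[of x] DERIV_dilog_series[of "1 - x"] that
      by (simp_all add: dilog_integrand_def)
    note [derivative_intros] = this(1)
      DERIV_chain2[where f = dilog_series and g = "\<lambda>x. 1 - x" and x = x, OF this(2)]
    show ?thesis
      using that by (auto intro!: derivative_eq_intros simp: divide_inverse algebra_simps)
  qed
  have "?G x = ?G z" if "0 < x" "x < 1" for x
    using deriv assms that by (intro DERIV_isconst3[of 0 1 x z ?G]) auto
  then have "\<forall>\<^sub>F x in at_right 0. ?G x = ?G z"
    unfolding eventually_at_right_field by (intro exI[of _ 1]) auto
  then have "(?G \<longlongrightarrow> ?G z) (at_right 0)"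
    by (rule tendsto_eventually)
  moreover have "(?G \<longlongrightarrow> dilog_series 0 + dilog_series (1 - 0) + 0) (at_right 0)"
  proof (intro tendsto_add)
    show "((\<lambda>x :: real. ln x * ln (1 - x)) \<longlongrightarrow> 0) (at_right 0)"
      by real_asymp
    have "isCont dilog_series 0"
      using DERIV_dilog_series[of 0] by (intro DERIV_isCont) simp
    then show "(dilog_series \<longlongrightarrow> dilog_series 0) (at_right 0)"
      by (auto simp: isCont_def intro: tendsto_within_subset)
    have "(dilog_series \<longlongrightarrow> dilog_series (1 - 0)) (at (1 - 0) within {-1..1})"
      using continuous_on_dilog_series by (auto simp: continuous_on_def)
    then show "((\<lambda>x. dilog_series (1 - x)) \<longlongrightarrow> dilog_series (1 - 0)) (at_right 0)"
    proof (rule filterlim_compose)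
      show "filterlim (\<lambda>x :: real. 1 - x) (at (1 - 0) within {-1..1}) (at_right 0)"
        unfolding filterlim_at
      proof
        show "((\<lambda>x :: real. 1 - x) \<longlongrightarrow> 1 - 0) (at_right 0)"
          by (intro tendsto_intros)
        show "\<forall>\<^sub>F x :: real in at_right 0. 1 - x \<in> {-1..1} \<and> 1 - x \<noteq> 1 - 0"
          unfolding eventually_at_right_field by (intro exI[of _ 1]) auto
      qed
    qed
  qed
  ultimately have "?G z = dilog_series 0 + dilog_series (1 - 0) + 0"
    by (intro tendsto_unique[OF _ \<open>(?G \<longlongrightarrow> ?G z) (at_right 0)\<close>]) auto
  moreover have "dilog_series 0 = 0"
    using dilog_eq_series[of 0] by simp
  ultimately show ?thesis
    using assms by (simp add: dilog_eq_series dilog_series_1)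
qed

section \<open>The convolution integral for the face\<close>

lemma second_sojourn_prob_equal:
  assumes "l > 0" "s \<ge> 0"
  shows "second_sojourn_prob l l s =
    l * s / ((1 + l * s) * (2 + l * s)) + 2 * ln (1 + l * s) / (2 + l * s)\<^sup>2"
proof -
  define y where "y = l * s"
  have y: "y \<ge> 0" using assms by (simp add: y_def)
  have K: "l + l + l * l * s = l * (2 + y)" by (simp add: y_def algebra_simps)
  have L: "ln ((1 + y) * (1 + y)) = 2 * ln (1 + y)" using y by (simp add: ln_mult)
  show ?thesis
    unfolding second_sojourn_prob_def K y_def[symmetric] L using y assms
    by (simp add: divide_simps) (simp add: algebra_simps power2_eq_square)
qed

text \<open>
  A primitive, for \<open>0 < u < a\<close>, of the integrand described at the beginning.  The summands are
  primitives of the partial fractions; the terms with \<open>u * ln u\<close>, corrected by a logarithm, belong to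
  \<open>ln u / (a - u)\<^sup>2\<close> and \<open>ln u / (1 + u)\<^sup>2\<close>, the dilogarithms to \<open>ln u / (a - u)\<close> and \<open>ln u / (1 + u)\<close>.
\<close>

definition face_antideriv :: "real \<Rightarrow> real \<Rightarrow> real" where
  "face_antideriv a u =
     2 / (a + 1)\<^sup>2 * ln (1 + u) - 1 / a\<^sup>2 * ln u - (2 / (a + 1)\<^sup>2 - 1 / a\<^sup>2) * ln (a - u)
     + (a - 1) / (a * (a + 1)) * (1 / (a - u))
     + 2 / (a + 1)\<^sup>2 *
       (1 / a * (u * ln u / (a - u)) + 1 / a * ln (a - u) + (u * ln u / (1 + u)) - ln (1 + u)
        + 2 / (a + 1) *
          ((- ln u * ln (1 - u / a) - dilog (u / a)) + (ln u * ln (1 + u) + dilog (- u))))"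

text \<open>
  The left-hand side is the term-by-term derivative of \<open>face_antideriv\<close>, with \<open>w = a - u\<close> and \<open>L\<close> for
  the logarithm of \<open>u\<close>.  As \<open>1 / w + 1 / v = b / (w * v)\<close> with \<open>v = 1 + u\<close> and \<open>b = v + w\<close>, squaring it
  yields the decomposition of the coefficient of \<open>L\<close>; the rest is a rational identity.
\<close>

lemma face_partial_fractions:
  fixes u w L :: real
  assumes "u > 0" "w > 0"
  shows "2 / (u + w + 1)\<^sup>2 * (1 / (1 + u)) - 1 / (u + w)\<^sup>2 * (1 / u)
      - (2 / (u + w + 1)\<^sup>2 - 1 / (u + w)\<^sup>2) * (- 1 / w)
      + (u + w - 1) / ((u + w) * (u + w + 1)) * (1 / w\<^sup>2)
      + 2 / (u + w + 1)\<^sup>2 *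
        (1 / (u + w) * ((u + w) * L / w\<^sup>2 + 1 / w) + 1 / (u + w) * (- 1 / w)
          + (L / (1 + u)\<^sup>2 + 1 / (1 + u)) - 1 / (1 + u)
          + 2 / (u + w + 1) * (L / w + L / (1 + u)))
    = 1 / w\<^sup>2 * ((u - 1) / (u * (1 + u)) + 2 * L / (1 + u)\<^sup>2)"
proof -
  define a b v where "a = u + w" and "b = u + w + 1" and "v = 1 + u"
  have nz: "u \<noteq> 0" "w \<noteq> 0" "a \<noteq> 0" "b \<noteq> 0" "v \<noteq> 0"
    using assms by (auto simp: a_def b_def v_def)
  have "1 / w + 1 / v = b / (w * v)"
    using nz by (simp add: b_def v_def field_simps)
  then have sq: "(1 / w + 1 / v)\<^sup>2 / b\<^sup>2 = 1 / (w\<^sup>2 * v\<^sup>2)"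
    using nz by (simp add: power_divide power_mult_distrib)
  have "1 / w\<^sup>2 + 1 / v\<^sup>2 + 2 / b * (1 / w + 1 / v) = (1 / w + 1 / v)\<^sup>2"
  proof -
    have "2 / b * (1 / w + 1 / v) = 2 / (w * v)"
      unfolding \<open>1 / w + 1 / v = b / (w * v)\<close> using nz by simp
    then show ?thesis by (simp add: power2_sum power_divide)
  qed
  then have log_part: "2 / b\<^sup>2 * (L / w\<^sup>2 + L / v\<^sup>2 + 2 / b * (L / w + L / v)) = 2 * L / (w\<^sup>2 * v\<^sup>2)"
  proof -
    have "2 / b\<^sup>2 * (L / w\<^sup>2 + L / v\<^sup>2 + 2 / b * (L / w + L / v)) =
        2 * L * ((1 / w\<^sup>2 + 1 / v\<^sup>2 + 2 / b * (1 / w + 1 / v)) / b\<^sup>2)"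
      by (simp add: divide_inverse algebra_simps)
    also have "\<dots> = 2 * L * (1 / (w\<^sup>2 * v\<^sup>2))"
      by (simp only: \<open>1 / w\<^sup>2 + 1 / v\<^sup>2 + 2 / b * (1 / w + 1 / v) = (1 / w + 1 / v)\<^sup>2\<close> sq)
    finally show ?thesis by simp
  qed
  have rational_part: "2 / b\<^sup>2 * (1 / v) - 1 / a\<^sup>2 * (1 / u) - (2 / b\<^sup>2 - 1 / a\<^sup>2) * (- 1 / w)
      + (a - 1) / (a * b) * (1 / w\<^sup>2) = (u - 1) / (w\<^sup>2 * u * v)"
  proof -
    have "2 / b\<^sup>2 * (1 / v) + 2 / b\<^sup>2 * (1 / w) = 2 / (b * v * w)"
    proof -
      have "2 / b\<^sup>2 * (1 / v) + 2 / b\<^sup>2 * (1 / w) = 2 / b\<^sup>2 * (1 / w + 1 / v)"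
        by (simp only: distrib_left add.commute)
      also have "\<dots> = 2 / (b * v * w)"
        unfolding \<open>1 / w + 1 / v = b / (w * v)\<close> using nz by (simp add: power2_eq_square mult.commute)
      finally show ?thesis .
    qed
    moreover have "1 / a\<^sup>2 * (1 / u) + 1 / a\<^sup>2 * (1 / w) = 1 / (a * u * w)"
    proof -
      have "1 / u + 1 / w = a / (u * w)" using nz by (simp add: a_def field_simps)
      then have "1 / a\<^sup>2 * (1 / u + 1 / w) = 1 / (a * u * w)"
        using nz by (simp add: power2_eq_square mult.commute)
      then show ?thesis by (simp only: distrib_left)
    qed
    moreover have "2 / (b * v * w) - 1 / (a * u * w) + (a - 1) / (a * b) * (1 / w\<^sup>2) = (u - 1) / (w\<^sup>2 * u * v)"
    proof -
      have poly: "2 * a * u * w - b * v * w + (a - 1) * u * v = (u - 1) * a * b"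
        by (simp add: a_def b_def v_def algebra_simps)
      have "2 / (b * v * w) - 1 / (a * u * w) + (a - 1) / (a * b) * (1 / w\<^sup>2) =
          (2 * a * u * w - b * v * w + (a - 1) * u * v) / (a * b * u * v * w\<^sup>2)"
        using nz by (simp add: divide_simps) (simp add: algebra_simps power2_eq_square)
      also have "\<dots> = (u - 1) / (w\<^sup>2 * u * v)"
        unfolding poly using nz by (simp add: divide_simps)
      finally show ?thesis .
    qed
    ultimately show ?thesis by (simp add: algebra_simps)
  qed
  have e: "1 / a * (a * L / w\<^sup>2 + 1 / w) = L / w\<^sup>2 + 1 / a * (1 / w)"
    using nz by (simp add: distrib_left)
  have "2 / b\<^sup>2 * (1 / v) - 1 / a\<^sup>2 * (1 / u) - (2 / b\<^sup>2 - 1 / a\<^sup>2) * (- 1 / w)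
      + (a - 1) / (a * b) * (1 / w\<^sup>2)
      + 2 / b\<^sup>2 *
        (1 / a * (a * L / w\<^sup>2 + 1 / w) + 1 / a * (- 1 / w)
          + (L / v\<^sup>2 + 1 / v) - 1 / v + 2 / b * (L / w + L / v))
    = (u - 1) / (w\<^sup>2 * u * v) + 2 * L / (w\<^sup>2 * v\<^sup>2)"
    unfolding rational_part e log_part[symmetric] by simp
  also have "\<dots> = 1 / w\<^sup>2 * ((u - 1) / (u * v) + 2 * L / v\<^sup>2)"
    by (simp add: distrib_left mult.assoc)
  finally show ?thesis
    unfolding a_def b_def v_def by (simp only: add.assoc add.commute add.left_commute)
qed

lemma DERIV_face_antideriv:
  assumes "0 < u" "u < a"
  shows "(face_antideriv a has_real_derivative
     1 / (a - u)\<^sup>2 * ((u - 1) / (u * (1 + u)) + 2 * ln u / (1 + u)\<^sup>2)) (at u)"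
proof -
  have "((\<lambda>u. ln (1 + u)) has_real_derivative 1 / (1 + u)) (at u)"
    "(ln has_real_derivative 1 / u) (at u)"
    "((\<lambda>u. ln (a - u)) has_real_derivative - 1 / (a - u)) (at u)"
    using assms by (auto intro!: derivative_eq_intros)
  note logs = this
  have inv: "((\<lambda>u. 1 / (a - u)) has_real_derivative 1 / (a - u)\<^sup>2) (at u)"
    using assms by (auto intro!: derivative_eq_intros simp: power2_eq_square)
  have "((\<lambda>u. u * ln u / (a - u)) has_real_derivative a * ln u / (a - u)\<^sup>2 + 1 / (a - u)) (at u)"
  proof -
    have "((\<lambda>u. u * ln u / (a - u)) has_real_derivative
        ((ln u + 1) * (a - u) + u * ln u) / ((a - u) * (a - u))) (at u)"
      using assms by (auto intro!: derivative_eq_intros)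
    moreover have "((ln u + 1) * (a - u) + u * ln u) / ((a - u) * (a - u)) =
        a * ln u / (a - u)\<^sup>2 + 1 / (a - u)"
    proof -
      have "(ln u + 1) * (a - u) + u * ln u = a * ln u + (a - u)" by (simp add: algebra_simps)
      then show ?thesis using assms by (simp add: add_divide_distrib power2_eq_square)
    qed
    ultimately show ?thesis by simp
  qed
  moreover have "((\<lambda>u. u * ln u / (1 + u)) has_real_derivative ln u / (1 + u)\<^sup>2 + 1 / (1 + u)) (at u)"
  proof -
    have "((\<lambda>u. u * ln u / (1 + u)) has_real_derivative
        ((ln u + 1) * (1 + u) - u * ln u) / ((1 + u) * (1 + u))) (at u)"
      using assms by (auto intro!: derivative_eq_intros)
    moreover have "((ln u + 1) * (1 + u) - u * ln u) / ((1 + u) * (1 + u)) =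
        ln u / (1 + u)\<^sup>2 + 1 / (1 + u)"
    proof -
      have "(ln u + 1) * (1 + u) - u * ln u = ln u + (1 + u)" by (simp add: algebra_simps)
      then show ?thesis
        using assms by (simp only: add_divide_distrib[of "ln u"]) (simp add: power2_eq_square)
    qed
    ultimately show ?thesis by simp
  qed
  moreover have "((\<lambda>u. - ln u * ln (1 - u / a) - dilog (u / a)) has_real_derivative ln u / (a - u)) (at u)"
  proof -
    have pos: "1 - u / a > 0" "u / a > 0" "u / a < 1" using assms by simp_all
    have d1: "((\<lambda>u. ln (1 - u / a)) has_real_derivative - 1 / (a - u)) (at u)"
    proof -
      have "((\<lambda>u. ln (1 - u / a)) has_real_derivative (0 - 1 / a) / (1 - u / a)) (at u)"
        using assms pos by (auto intro!: derivative_eq_intros)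
      moreover have "(0 - 1 / a) / (1 - u / a) = - 1 / (a - u)"
        using assms by (simp add: field_simps)
      ultimately show ?thesis by simp
    qed
    have d2: "((\<lambda>u. dilog (u / a)) has_real_derivative dilog_integrand (u / a) * (1 / a)) (at u)"
      using pos by (intro DERIV_chain2[OF DERIV_dilog] DERIV_cdivide DERIV_ident)
    have d3: "dilog_integrand (u / a) * (1 / a) = - ln (1 - u / a) / u"
      using assms by (simp add: dilog_integrand_def)
    have "((\<lambda>u. - ln u * ln (1 - u / a) - dilog (u / a)) has_real_derivative
        - (1 / u) * ln (1 - u / a) + - 1 / (a - u) * - ln u - - ln (1 - u / a) / u) (at u)"
      using d2 unfolding d3 by (intro DERIV_diff DERIV_mult DERIV_minus logs d1)
    then show ?thesis by simp
  qed
  moreover have "((\<lambda>u. ln u * ln (1 + u) + dilog (- u)) has_real_derivative ln u / (1 + u)) (at u)"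
  proof -
    have d2: "((\<lambda>u. dilog (- u)) has_real_derivative dilog_integrand (- u) * - 1) (at u)"
      using assms by (intro DERIV_chain2[OF DERIV_dilog] DERIV_minus DERIV_ident) simp
    have d3: "dilog_integrand (- u) * - 1 = - ln (1 + u) / u"
      using assms by (simp add: dilog_integrand_def)
    have "((\<lambda>u. ln u * ln (1 + u) + dilog (- u)) has_real_derivative
        1 / u * ln (1 + u) + 1 / (1 + u) * ln u + - ln (1 + u) / u) (at u)"
      using d2 unfolding d3 by (intro DERIV_add DERIV_mult logs)
    then show ?thesis by simp
  qed
  ultimately have "(face_antideriv a has_real_derivative
      2 / (a + 1)\<^sup>2 * (1 / (1 + u)) - 1 / a\<^sup>2 * (1 / u) - (2 / (a + 1)\<^sup>2 - 1 / a\<^sup>2) * (- 1 / (a - u))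
      + (a - 1) / (a * (a + 1)) * (1 / (a - u)\<^sup>2)
      + 2 / (a + 1)\<^sup>2 *
        (1 / a * (a * ln u / (a - u)\<^sup>2 + 1 / (a - u)) + 1 / a * (- 1 / (a - u))
          + (ln u / (1 + u)\<^sup>2 + 1 / (1 + u)) - 1 / (1 + u)
          + 2 / (a + 1) * (ln u / (a - u) + ln u / (1 + u)))) (at u)"
    unfolding face_antideriv_def[abs_def] using logs inv
    by (intro DERIV_add DERIV_diff DERIV_cmult)
  then show ?thesis
    using face_partial_fractions[of u "a - u" "ln u"] assms by simp
qed

text \<open>
  The terms \<open>ln 2\<close> at the lower limit cancel.  The reflection formula at \<open>(1 + x) / (2 + x)\<close> eliminates
  \<open>Li\<^sub>2(1 / (2 + x))\<close>, which doubles the other dilogarithm and, together with \<open>Li\<^sub>2(-1)\<close>, produces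
  \<open>\<pi>\<^sup>2 / 6 + \<pi>\<^sup>2 / 12 = \<pi>\<^sup>2 / 4\<close>.
\<close>

lemma R_face_eq_antideriv:
  assumes "x \<ge> 0" "x = l * t"
  shows "face_antideriv (2 + x) (1 + x) - face_antideriv (2 + x) 1 = R_face l t"
proof -
  define a b where "a = 2 + x" and "b = 3 + x"
  define L M P Q where "L = ln (1 + x)" and "M = ln (2 + x)"
    and "P = dilog ((1 + x) / (2 + x))" and "Q = dilog (- (1 + x))"
  have a: "a > 1" "b > 0" and x: "x = a - 2" "b = a + 1" using assms by (auto simp: a_def b_def)
  have z: "1 - (1 + x) / (2 + x) = 1 / (2 + x)"
    using assms by (simp add: field_simps)
  have lns: "ln (1 / (2 + x)) = - M" "ln ((1 + x) / (2 + x)) = L - M"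
    using assms by (simp_all add: ln_div L_def M_def)
  have "dilog (1 / (2 + x)) = pi\<^sup>2 / 6 + (L - M) * M - P"
    using dilog_reflection[of "(1 + x) / (2 + x)"] assms
    unfolding z lns P_def[symmetric] by simp
  then have S: "dilog (1 / a) = pi\<^sup>2 / 6 + (L - M) * M - P"
    by (simp add: a_def)
  have La: "ln (a - 1) = L"
    by (simp add: a_def L_def)
  have H1: "face_antideriv a 1 = - (2 / b\<^sup>2 - 1 / a\<^sup>2) * L + (a - 1) / (a * b) * (1 / (a - 1))
      + 2 / b\<^sup>2 * (1 / a * L + 2 / b * (P - pi\<^sup>2 / 6 - (L - M) * M - pi\<^sup>2 / 12))"
    unfolding face_antideriv_def La S dilog_minus_1 x(2)[symmetric]
    by (simp add: algebra_simps)
  have Hx: "face_antideriv a (1 + x) = 2 / b\<^sup>2 * M - 1 / a\<^sup>2 * L + (a - 1) / (a * b)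
      + 2 / b\<^sup>2 * (2 / a * ((a - 1) * L) - M + 2 / b * (L * M - P + L * M + Q))"
    unfolding face_antideriv_def a_def b_def z lns
    by (simp only: L_def[symmetric] M_def[symmetric] P_def[symmetric] Q_def[symmetric])
      (simp add: M_def algebra_simps)
  have lt: "l * t = x" "2 * l * t = 2 * x" using assms by simp_all
  have R: "R_face l t = 1 / (a\<^sup>2 * b ^ 3) * (2 * L * (b * ((a - 2) * (2 * a - 1) - 3) + 4 * a\<^sup>2 * M)
      + a * (pi\<^sup>2 * a + (a - 2) * b\<^sup>2 + 4 * a * M * (L - M)) + 4 * a\<^sup>2 * (Q - 2 * P))"
    unfolding R_face_def lt lns
    by (simp add: a_def b_def L_def M_def P_def Q_def)
  show ?thesis
    unfolding a_def[symmetric] H1 Hx R using a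
    by (simp add: divide_simps) (simp add: x algebra_simps power2_eq_square power3_eq_cube)
qed

text \<open>
  Nonnegativity is recorded because \<open>ennreal\<close> maps negative numbers to \<open>0\<close>, so that the first
  equation alone would not determine \<open>R_face l t\<close>.
\<close>

lemma
  assumes l: "l > 0" and t: "t \<ge> 0"
  shows nn_integral_third_sojourn:
    "(\<integral>\<^sup>+s. ennreal (l / (1 + l * s)\<^sup>2 * second_sojourn_prob l l (t - s)) * indicator {0..t} s \<partial>lborel) =
      ennreal (R_face l t)"
    and R_face_nonneg: "R_face l t \<ge> 0"
proof -
  define a where "a = 2 + l * t"
  let ?u = "\<lambda>s. 1 + l * (t - s)"
  let ?f = "\<lambda>s. l / (1 + l * s)\<^sup>2 * second_sojourn_prob l l (t - s)"
  have f: "((\<lambda>s. - face_antideriv a (?u s)) has_real_derivative ?f s) (at s)" "0 \<le> ?f s"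
    if s: "s \<in> {0..t}" for s
  proof -
    have u: "?u s \<ge> 1" "a - ?u s = 1 + l * s" "l * s \<ge> 0"
      using l s by (simp_all add: a_def algebra_simps)
    have eq: "second_sojourn_prob l l (t - s) =
        (?u s - 1) / (?u s * (1 + ?u s)) + 2 * ln (?u s) / (1 + ?u s)\<^sup>2"
      using second_sojourn_prob_equal[OF l, of "t - s"] s by (simp add: add.assoc[symmetric])
    have "((\<lambda>s. - face_antideriv a (?u s)) has_real_derivative
      - (1 / (a - ?u s)\<^sup>2 * ((?u s - 1) / (?u s * (1 + ?u s)) + 2 * ln (?u s) / (1 + ?u s)\<^sup>2) * (l * (0 - 1)))) (at s)"
      using u by (intro DERIV_minus DERIV_chain2[OF DERIV_face_antideriv])
        (auto intro!: derivative_eq_intros)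
    then show "((\<lambda>s. - face_antideriv a (?u s)) has_real_derivative ?f s) (at s)"
      unfolding eq u(2) by (simp add: mult.commute)
    show "0 \<le> ?f s"
      unfolding eq using u l by simp
  qed
  have diff: "- face_antideriv a (?u t) - - face_antideriv a (?u 0) = R_face l t"
    using R_face_eq_antideriv[of "l * t" l t] l t by (simp add: a_def)
  have "(\<lambda>s. second_sojourn_prob l l (t - s)) \<in> borel_measurable borel"
    unfolding second_sojourn_prob_def by measurable
  then have "?f \<in> borel_measurable borel"
    by measurable
  from nn_integral_FTC_Icc[OF this, where F = "\<lambda>s. - face_antideriv a (?u s)", OF f t]
  show "(\<integral>\<^sup>+s. ennreal (?f s) * indicator {0..t} s \<partial>lborel) = ennreal (R_face l t)"
    by (simp only: diff)
  have "- face_antideriv a (?u 0) \<le> - face_antideriv a (?u t)"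
    using t f by (intro DERIV_nonneg_imp_nondecreasing[where f = "\<lambda>s. - face_antideriv a (?u s)"]) auto
  then show "R_face l t \<ge> 0"
    using diff by simp
qed

section \<open>The three probabilities\<close>

text \<open>
  Independence of one variable from a function of others, as a product law: the restrictions to
  \<open>{i}\<close> and \<open>J\<close> are independent, and the laws are pushed forward along evaluation at \<open>i\<close> and along \<open>g\<close>.
\<close>

lemma (in prob_space) distr_pair_indep_vars:
  fixes X :: "'i \<Rightarrow> 'a \<Rightarrow> real"
  assumes ind: "indep_vars (\<lambda>_. borel) X I" and "i \<in> I" "J \<subseteq> I" "i \<notin> J"
    and g: "g \<in> (\<Pi>\<^sub>M j\<in>J. borel) \<rightarrow>\<^sub>M N"
  shows "distr M lborel (X i) \<Otimes>\<^sub>M distr M N (\<lambda>\<omega>. g (\<lambda>j\<in>J. X j \<omega>)) =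
    distr M (lborel \<Otimes>\<^sub>M N) (\<lambda>\<omega>. (X i \<omega>, g (\<lambda>j\<in>J. X j \<omega>)))"
proof -
  let ?P = "\<Pi>\<^sub>M j\<in>{i}. (borel :: real measure)" and ?Q = "\<Pi>\<^sub>M j\<in>J. (borel :: real measure)"
  let ?R = "\<lambda>\<omega>. \<lambda>j\<in>{i}. X j \<omega>" and ?S = "\<lambda>\<omega>. \<lambda>j\<in>J. X j \<omega>"
  have indep: "indep_var ?P ?R ?Q ?S"
    using assms by (intro indep_var_restrict[OF ind]) auto
  have R: "?R \<in> M \<rightarrow>\<^sub>M ?P" and S: "?S \<in> M \<rightarrow>\<^sub>M ?Q"
    using indep by (auto simp: indep_var_eq)
  have f: "(\<lambda>x. x i) \<in> ?P \<rightarrow>\<^sub>M lborel"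
    by (simp add: measurable_component_singleton)
  have "distr (distr M ?P ?R) lborel (\<lambda>x. x i) \<Otimes>\<^sub>M distr (distr M ?Q ?S) N g =
      distr (distr M ?P ?R \<Otimes>\<^sub>M distr M ?Q ?S) (lborel \<Otimes>\<^sub>M N) (\<lambda>(x, y). (x i, g y))"
  proof (rule pair_measure_distr)
    interpret S: prob_space "distr M ?Q ?S" using S by (rule prob_space_distr)
    interpret Q: prob_space "distr (distr M ?Q ?S) N g"
      by (rule S.prob_space_distr) (use g in simp)
    show "sigma_finite_measure (distr (distr M ?Q ?S) N g)" by unfold_locales
  qed (use f g in simp_all)
  also have "distr M ?P ?R \<Otimes>\<^sub>M distr M ?Q ?S = distr M (?P \<Otimes>\<^sub>M ?Q) (\<lambda>\<omega>. (?R \<omega>, ?S \<omega>))"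
    using indep by (simp add: indep_var_distribution_eq)
  also have "distr \<dots> (lborel \<Otimes>\<^sub>M N) (\<lambda>(x, y). (x i, g y)) =
      distr M (lborel \<Otimes>\<^sub>M N) ((\<lambda>(x, y). (x i, g y)) \<circ> (\<lambda>\<omega>. (?R \<omega>, ?S \<omega>)))"
  proof (rule distr_distr)
    have "(\<lambda>z. (fst z i, g (snd z))) \<in> ?P \<Otimes>\<^sub>M ?Q \<rightarrow>\<^sub>M lborel \<Otimes>\<^sub>M N"
      by (intro measurable_Pair measurable_compose[OF measurable_fst f] measurable_compose[OF measurable_snd g])
    then show "(\<lambda>(x, y). (x i, g y)) \<in> ?P \<Otimes>\<^sub>M ?Q \<rightarrow>\<^sub>M lborel \<Otimes>\<^sub>M N"
      by (simp add: case_prod_beta')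
    show "(\<lambda>\<omega>. (?R \<omega>, ?S \<omega>)) \<in> M \<rightarrow>\<^sub>M ?P \<Otimes>\<^sub>M ?Q"
      using R S by (intro measurable_Pair)
  qed
  also have "distr (distr M ?P ?R) lborel (\<lambda>x. x i) = distr M lborel (X i)"
    by (subst distr_distr[OF f R]) (simp add: comp_def)
  also have "distr (distr M ?Q ?S) N g = distr M N (\<lambda>\<omega>. g (?S \<omega>))"
    by (subst distr_distr[OF g S]) (simp add: comp_def)
  finally show ?thesis by (simp add: comp_def restrict_def)
qed

text \<open>
  The conditioning event has probability \<open>1\<close>, since the velocity at time \<open>0\<close> is \<open>dir 1\<close> as soon as the
  first duration is positive.  All first durations are almost surely positive, so
  \<open>P\<close> and \<open>E\<close> are almost surely equivalent.
\<close>

lemma prob1_eq_measure: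
  assumes M: "prob_space M"
    and D: "\<And>j k. j \<in> {1..4} \<Longrightarrow> k \<ge> 1 \<Longrightarrow> D j k \<in> borel_measurable M"
    and pos: "AE \<omega> in M. \<forall>j\<in>{1..4}. D j 1 \<omega> > 0"
    and PE: "\<And>\<omega>. \<omega> \<in> space M \<Longrightarrow> (\<And>j. j \<in> {1..4} \<Longrightarrow> D j 1 \<omega> > 0) \<Longrightarrow> P \<omega> \<longleftrightarrow> E \<omega>"
    and P [measurable]: "Measurable.pred M P" and E [measurable]: "Measurable.pred M E"
  shows "prob1 M c D P = measure M {\<omega> \<in> space M. E \<omega>}"
proof -
  interpret prob_space M by fact
  have [measurable]: "velocity D 0 \<in> borel_measurable M" "position c D 0 \<in> borel_measurable M"
    by (rule velocity_measurable position_measurable; rule D; assumption)+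
  let ?Q = "\<lambda>\<omega>. position c D 0 \<omega> = 0 \<and> velocity D 0 \<omega> = dir 1"
  have Q: "?Q \<omega>" if "\<forall>j\<in>{1..4}. D j 1 \<omega> > 0" for \<omega>
    using velocity_first_cycle[of D \<omega> 0 0] that switch_times[of D \<omega>] by (simp add: position_def)
  have "AE \<omega> in M. ?Q \<omega>"
    using pos by eventually_elim (rule Q)
  then have "prob {\<omega> \<in> space M. ?Q \<omega>} = 1"
    by (subst prob_Collect_eq_1) auto
  moreover have "prob {\<omega> \<in> space M. P \<omega> \<and> ?Q \<omega>} = prob {\<omega> \<in> space M. E \<omega>}"
  proof (rule finite_measure_eq_AE)
    show "AE \<omega> in M. \<omega> \<in> {\<omega> \<in> space M. P \<omega> \<and> ?Q \<omega>} \<longleftrightarrow> \<omega> \<in> {\<omega> \<in> space M. E \<omega>}"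
      using pos AE_space
    proof eventually_elim
      case (elim \<omega>)
      then show ?case using PE[of \<omega>] Q[of \<omega>] by blast
    qed
  qed measurable
  ultimately show ?thesis
    by (simp add: prob1_def cond_prob_def)
qed

lemma second_sojourn_prob_nonneg:
  assumes "a > 0" "b > 0" "t \<ge> 0"
  shows "second_sojourn_prob a b t \<ge> 0"
proof -
  have "1 + a * t \<ge> 1" "1 + b * t \<ge> 1" using assms by simp_all
  then have "(1 + a * t) * (1 + b * t) \<ge> 1"
    using mult_mono[of 1 "1 + a * t" 1 "1 + b * t"] by linarith
  then show ?thesis
    using assms by (simp add: second_sojourn_prob_def)
qed

theorem theorem4:
  fixes M :: "'a measure" and D :: "nat \<Rightarrow> nat \<Rightarrow> 'a \<Rightarrow> real"
    and lam :: "nat \<Rightarrow> real" and c t :: real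
  assumes "prob_space M"
    and "c > 0"
    and "\<And>j. j \<in> {1..4} \<Longrightarrow> lam j > 0"
    and "\<And>j. j \<in> {1..4} \<Longrightarrow> gcp_interarrivals M (lam j) (D j)"
    and "prob_space.indep_vars M (\<lambda>_. \<Pi>\<^sub>M k\<in>{1..}. (borel :: real measure))
           (\<lambda>j \<omega>. \<lambda>k\<in>{1..}. D j k \<omega>) {1..4}"
    and "t \<ge> 0"
  shows "prob1 M c D (\<lambda>\<omega>. position c D t \<omega> = vector [c * t, 0, 0] \<and> velocity D t \<omega> = dir 1)
           = 1 / (1 + lam 1 * t)
       \<and> prob1 M c D (\<lambda>\<omega>. position c D t \<omega> \<in> edge12 c t \<and> velocity D t \<omega> = dir 2)
           = lam 1 / (lam 1 + lam 2 + lam 1 * lam 2 * t)\<^sup>2 *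
             (lam 1 * t * (lam 1 + lam 2 + lam 1 * lam 2 * t) / (1 + lam 1 * t)
              + lam 2 * ln ((1 + lam 1 * t) * (1 + lam 2 * t)))
       \<and> (\<forall>l. lam 1 = l \<and> lam 2 = l \<and> lam 3 = l \<longrightarrow>
            prob1 M c D (\<lambda>\<omega>. position c D t \<omega> \<in> face123 c t \<and> velocity D t \<omega> = dir 3)
              = R_face l t)"
proof -
  interpret prob_space M by fact
  have lam: "lam 1 > 0" "lam 2 > 0" "lam 3 > 0"
    and gcp: "gcp_interarrivals M (lam 1) (D 1)" "gcp_interarrivals M (lam 2) (D 2)"
      "gcp_interarrivals M (lam 3) (D 3)"
    using assms(3,4) by simp_all
  have D: "D j k \<in> borel_measurable M" if "j \<in> {1..4}" "k \<ge> 1" for j k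
    using assms(4)[OF that(1)] that(2) by (simp add: gcp_interarrivals_def)
  have D1 [measurable]: "D 1 1 \<in> borel_measurable M" "D 2 1 \<in> borel_measurable M" "D 3 1 \<in> borel_measurable M"
    by (intro D; simp)+
  note D1 [unfolded One_nat_def, measurable]
  have [measurable]: "position c D t \<in> borel_measurable M" "velocity D t \<in> borel_measurable M"
    by (rule velocity_measurable position_measurable; rule D; assumption)+
  have "AE \<omega> in M. D j 1 \<omega> > 0" if "j \<in> {1..4}" for j
    using gcp_interarrival_pos[OF assms(1) assms(3)[OF that] assms(4)[OF that]] .
  then have pos: "AE \<omega> in M. \<forall>j\<in>{1..4}. D j 1 \<omega> > 0"
    by (intro AE_finite_allI) auto
  have integrable: "(\<lambda>s. velocity D s \<omega>) integrable_on {0..t}" if "\<omega> \<in> space M" for \<omega>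
    using that by (rule velocity_integrable_on[rotated]) (rule D)
  have prob1: "prob1 M c D P = measure M {\<omega> \<in> space M. E \<omega>}"
    if "\<And>\<omega>. \<omega> \<in> space M \<Longrightarrow> (\<And>j. j \<in> {1..4} \<Longrightarrow> D j 1 \<omega> > 0) \<Longrightarrow> P \<omega> \<longleftrightarrow> E \<omega>"
      "Measurable.pred M P" "Measurable.pred M E" for P E
    by (rule prob1_eq_measure[where M = M and D = D and P = P and E = E, OF assms(1) D pos that])

  have "indep_vars (\<lambda>_. borel) (\<lambda>j \<omega>. (\<lambda>k\<in>{1..}. D j k \<omega>) 1) {1..4}"
    by (rule indep_vars_compose2[OF assms(5)]) (simp add: measurable_component_singleton)
  then have indep: "indep_vars (\<lambda>_. borel) (\<lambda>j. D j 1) {1..4}"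
    by simp
  have indep2: "distr M lborel (D i 1) \<Otimes>\<^sub>M distr M borel (D j 1) =
      distr M (lborel \<Otimes>\<^sub>M borel) (\<lambda>\<omega>. (D i 1 \<omega>, D j 1 \<omega>))"
    if "i \<in> {1..4}" "j \<in> {1..4}" "i \<noteq> j" for i j
    using distr_pair_indep_vars[OF indep, of i "{j}" "\<lambda>x. x j" borel] that
    by (simp add: measurable_component_singleton)
  have indep3: "distr M lborel (D 1 1) \<Otimes>\<^sub>M distr M (borel \<Otimes>\<^sub>M borel) (\<lambda>\<omega>. (D 2 1 \<omega>, D 3 1 \<omega>)) =
      distr M (lborel \<Otimes>\<^sub>M (borel \<Otimes>\<^sub>M borel)) (\<lambda>\<omega>. (D 1 1 \<omega>, (D 2 1 \<omega>, D 3 1 \<omega>)))"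
  proof -
    have "(\<lambda>x. (x 2, x 3)) \<in> (\<Pi>\<^sub>M j\<in>{2, 3 :: nat}. borel :: real measure) \<rightarrow>\<^sub>M borel \<Otimes>\<^sub>M borel"
      by (intro measurable_Pair measurable_component_singleton) auto
    from distr_pair_indep_vars[OF indep, of 1 "{2, 3}", OF _ _ _ this]
    show ?thesis by simp
  qed

  have "prob1 M c D (\<lambda>\<omega>. position c D t \<omega> = vector [c * t, 0, 0] \<and> velocity D t \<omega> = dir 1) =
      measure M {\<omega> \<in> space M. t < D 1 1 \<omega>}"
    by (rule prob1[OF at_vertex_iff]) (simp_all add: integrable assms)
  then have vertex: "prob1 M c D (\<lambda>\<omega>. position c D t \<omega> = vector [c * t, 0, 0] \<and> velocity D t \<omega> = dir 1) =
      1 / (1 + lam 1 * t)"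
    using gcp_interarrival_tail[OF assms(1) lam(1) gcp(1) assms(6)] by simp

  have [measurable]: "edge12 c t \<in> sets borel"
    by (simp add: edge12_def)
  have "prob1 M c D (\<lambda>\<omega>. position c D t \<omega> \<in> edge12 c t \<and> velocity D t \<omega> = dir 2) =
      measure M {\<omega> \<in> space M. D 1 1 \<omega> \<le> t \<and> t < D 1 1 \<omega> + D 2 1 \<omega>}"
    by (rule prob1[OF on_edge_iff]) (simp_all add: integrable assms)
  also have "\<dots> = second_sojourn_prob (lam 1) (lam 2) t"
    using emeasure_second_sojourn[OF lam(1,2) gcp(1,2) indep2 assms(6)]
      second_sojourn_prob_nonneg[OF lam(1,2) assms(6)]
    by (simp add: measure_def)
  finally have edge: "prob1 M c D (\<lambda>\<omega>. position c D t \<omega> \<in> edge12 c t \<and> velocity D t \<omega> = dir 2) =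
      second_sojourn_prob (lam 1) (lam 2) t" .

  have [measurable]: "face123 c t \<in> sets borel"
    unfolding face123_def by (intro borel_closed compact_imp_closed finite_imp_compact_convex_hull) auto
  have face: "prob1 M c D (\<lambda>\<omega>. position c D t \<omega> \<in> face123 c t \<and> velocity D t \<omega> = dir 3) = R_face l t"
    if l: "lam 1 = l" "lam 2 = l" "lam 3 = l" for l
  proof -
    have "prob1 M c D (\<lambda>\<omega>. position c D t \<omega> \<in> face123 c t \<and> velocity D t \<omega> = dir 3) =
        measure M {\<omega> \<in> space M. D 1 1 \<omega> + D 2 1 \<omega> \<le> t \<and> t < D 1 1 \<omega> + D 2 1 \<omega> + D 3 1 \<omega>}"
      by (rule prob1[OF on_face_iff]) (simp_all add: integrable assms)
    also have "\<dots> = R_face l t"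
      using emeasure_third_sojourn[OF lam gcp indep3 indep2 assms(6)]
        nn_integral_third_sojourn[of l t] R_face_nonneg[of l t] lam assms(6) l
      by (simp add: measure_def)
    finally show ?thesis .
  qed
  show ?thesis
    using vertex edge face unfolding second_sojourn_prob_def by blast
qed

end
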